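(* Let $n \ge 1$, $\varepsilon > 0$, $\alpha \in (0,1]$ and $\beta_{\rm I}, \beta_{\rm II} \in (0,1)$, and set $\beta = \min(\beta_{\rm I}, \beta_{\rm II})$. For every (explicitly given) distribution $q$ over $[n]$ there exists an $(\varepsilon,0)$-differentially private algorithm for the $(\alpha, \beta_{\rm I}, \beta_{\rm II})$-identity testing problem with respect to $q$ which uses $$m = \tilde O\left(\max \left\{\frac{\sqrt{n}}{\alpha^2}, \frac{\sqrt{n}}{\alpha^{3/2}\varepsilon}, \frac{n^{1/3}}{\alpha^{5/3}\varepsilon^{2/3}}\right\} \cdot \log (1/\beta) \right)$$ samples from the unknown distribution $p$.
   Context: All distributions are discrete distributions over $[n]=\{1,\dots,n\}$; $p_i$ denotes the mass that $p$ places on $i$. The total variation distance is $d_{\mathrm{TV}}(p,q) = \frac12\sum_{i\in[n]}|p_i-q_i|$. A dataset of samples is identified with its vector of counts in $\mathbb{N}^n$. A randomized algorithm $M$ with domain $\mathbb{N}^n$ is $(\varepsilon,\delta)$-differentially private if for all measurable $S\subseteq \mathrm{Range}(M)$ and all pairs of inputs $D,D'$ with $\|D-D'\|_1\le 1$, $\Pr[M(D)\in S]\le e^{\varepsilon}\Pr[M(D')\in S]+\delta$; privacy must hold for every possible dataset, not only for samples from the two cases below. An algorithm for the $(\alpha,\beta_{\rm I},\beta_{\rm II})$-identity testing problem with respect to a known distribution $q$ takes $m$ samples from an unknown distribution $p$ and: if $p=q$, outputs "$p=q$" with probability at least $1-\beta_{\rm I}$; if $d_{\mathrm{TV}}(p,q)\ge\alpha$,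 outputs "$p\neq q$" with probability at least $1-\beta_{\rm II}$ (otherwise the output may be arbitrary). $\tilde O(\cdot)$ hides polylogarithmic factors (in $n$). *)

theory Defs
  imports "HOL-Probability.Probability"
begin

definition is_dist_on :: "nat \<Rightarrow> nat pmf \<Rightarrow> bool" where
  "is_dist_on n p \<longleftrightarrow> set_pmf p \<subseteq> {1..n}"

definition dTV :: "nat \<Rightarrow> nat pmf \<Rightarrow> nat pmf \<Rightarrow> real" where
  "dTV n p q = (1/2) * (\<Sum>i\<in>{1..n}. \<bar>pmf p i - pmf q i\<bar>)"

text \<open>Datasets over [n] are identified with count vectors in N^n, represented as
  functions nat => nat vanishing outside {1..n}.\<close>
definition is_dataset :: "nat \<Rightarrow> (nat \<Rightarrow> nat) \<Rightarrow> bool" where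
  "is_dataset n D \<longleftrightarrow> (\<forall>i. i \<notin> {1..n} \<longrightarrow> D i = 0)"

definition l1_dist :: "nat \<Rightarrow> (nat \<Rightarrow> nat) \<Rightarrow> (nat \<Rightarrow> nat) \<Rightarrow> real" where
  "l1_dist n D D' = (\<Sum>i\<in>{1..n}. \<bar>real (D i) - real (D' i)\<bar>)"

definition diff_private ::
  "nat \<Rightarrow> real \<Rightarrow> real \<Rightarrow> ((nat \<Rightarrow> nat) \<Rightarrow> 'b pmf) \<Rightarrow> bool" where
  "diff_private n \<epsilon> \<delta> M \<longleftrightarrow>
     (\<forall>D D' S. is_dataset n D \<and> is_dataset n D' \<and> l1_dist n D D' \<le> 1 \<longrightarrow>
        measure_pmf.prob (M D) S \<le> exp \<epsilon> * measure_pmf.prob (M D') S + \<delta>)"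

fun sample_counts :: "nat pmf \<Rightarrow> nat \<Rightarrow> (nat \<Rightarrow> nat) pmf" where
  "sample_counts p 0 = return_pmf (\<lambda>_. 0)"
| "sample_counts p (Suc m) =
     bind_pmf (sample_counts p m) (\<lambda>D. map_pmf (\<lambda>i. D(i := D i + 1)) p)"

definition identity_tester ::
  "nat \<Rightarrow> nat pmf \<Rightarrow> real \<Rightarrow> real \<Rightarrow> real \<Rightarrow> nat \<Rightarrow> ((nat \<Rightarrow> nat) \<Rightarrow> bool pmf) \<Rightarrow> bool" where
  "identity_tester n q \<alpha> \<beta>I \<beta>II m M \<longleftrightarrow>
     (\<forall>p. is_dist_on n p \<longrightarrow>
        (p = q \<longrightarrow> measure_pmf.prob (bind_pmf (sample_counts p m) M) {True} \<ge> 1 - \<beta>I) \<and>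
        (dTV n p q \<ge> \<alpha> \<longrightarrow> measure_pmf.prob (bind_pmf (sample_counts p m) M) {False} \<ge> 1 - \<beta>II))"

end

theory Submission
  imports Defs
begin

text \<open>
  Let \<open>w\<^sub>i = q\<^sub>i + 1/n\<close>. For two independent halves of \<open>m\<close> samples each, with counts \<open>N\<close> and \<open>N'\<close>,
  consider \<open>B = \<Sum>\<^sub>i \<psi>\<^sub>i (N\<^sub>i - m q\<^sub>i) \<psi>\<^sub>i (N'\<^sub>i - m q\<^sub>i) / (m w\<^sub>i)\<close>, where \<open>\<psi>\<^sub>i\<close> clips at
  \<open>\<plusminus> m \<alpha> \<surd>w\<^sub>i\<close>. Independence of the halves gives \<open>B\<close> mean close to zero if \<open>p = q\<close>, and mean of order at
  least \<open>m \<alpha>\<^sup>2\<close> if \<open>p\<close> is \<open>\<alpha>\<close>-far from \<open>q\<close>: either some coordinate saturates the clipping, or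
  Cauchy-Schwarz applies to \<open>\<Sum>\<^sub>i |p\<^sub>i - q\<^sub>i|\<close>. The Efron-Stein inequality bounds the standard
  deviation by a small multiple of this gap once \<open>m \<ge> K \<surd>n / \<alpha>\<^sup>2\<close>. The clipping makes
  \<open>B / (m \<alpha>\<^sup>2)\<close> change by at most \<open>O(\<surd>n / (m \<alpha>))\<close> when one sample is replaced, which is at most
  \<open>\<epsilon>\<close> once \<open>m \<ge> K \<surd>n / (\<alpha> \<epsilon>)\<close>. Truncating to \<open>[0,1]\<close>, summing over \<open>O(log (1/\<beta>))\<close> independent
  batches and answering with log-odds given by the centred sum yields the tester; since it reads
  ordered samples, the mechanism averages over all orderings of the dataset.
\<close>

section \<open>Expectations over lists of independent samples\<close>

text \<open>Expectation of \<open>f\<close> over \<open>m\<close> independent draws, written as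
  nested finite sums so that no integrability conditions arise. Over infinite support these sums
  collapse to zero, hence the finiteness assumptions wherever total mass one enters.\<close>

primrec iidE :: "'a pmf \<Rightarrow> nat \<Rightarrow> ('a list \<Rightarrow> real) \<Rightarrow> real" where
  "iidE p 0 f = f []"
| "iidE p (Suc m) f = (\<Sum>x\<in>set_pmf p. pmf p x * iidE p m (\<lambda>xs. f (x # xs)))"

lemma iidE_mono:
  assumes "\<And>xs. length xs = m \<Longrightarrow> set xs \<subseteq> set_pmf p \<Longrightarrow> f xs \<le> g xs"
  shows "iidE p m f \<le> iidE p m g"
  using assms
proof (induction m arbitrary: f g)
  case (Suc m)
  show ?case
    unfolding iidE.simps
    by (intro sum_mono mult_left_mono Suc.IH) (simp_all add: Suc.prems)
qed simp

lemma iidE_cong: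
  assumes "\<And>xs. length xs = m \<Longrightarrow> set xs \<subseteq> set_pmf p \<Longrightarrow> f xs = g xs"
  shows "iidE p m f = iidE p m g"
  by (intro antisym iidE_mono) (auto simp: assms)

lemma iidE_add: "iidE p m (\<lambda>xs. f xs + g xs) = iidE p m f + iidE p m g"
  by (induction m arbitrary: f g) (simp_all add: sum.distrib algebra_simps)

lemma iidE_cmult: "iidE p m (\<lambda>xs. c * f xs) = c * iidE p m f"
  by (induction m arbitrary: f) (simp_all add: sum_distrib_left algebra_simps)

lemma iidE_diff: "iidE p m (\<lambda>xs. f xs - g xs) = iidE p m f - iidE p m g"
  by (induction m arbitrary: f g) (simp_all add: sum_subtractf right_diff_distrib)

lemma iidE_sum: "iidE p m (\<lambda>xs. \<Sum>i\<in>I. f i xs) = (\<Sum>i\<in>I. iidE p m (f i))"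
proof (induction m arbitrary: f)
  case (Suc m)
  show ?case
    by (simp add: Suc.IH sum_distrib_left sum.swap[of _ I])
qed simp

lemma iidE_const:
  assumes "finite (set_pmf p)"
  shows "iidE p m (\<lambda>_. c) = c"
  by (induction m) (simp_all add: sum_pmf_eq_1[OF assms] flip: sum_distrib_right)

lemma iidE_append:
  "iidE p (a + b) f = iidE p a (\<lambda>xs. iidE p b (\<lambda>ys. f (xs @ ys)))"
  by (induction a arbitrary: f) simp_all

text \<open>Jensen: the mean squared deviation from \<open>?c\<close> is nonnegative.\<close>

lemma iidE_square_le:
  assumes "finite (set_pmf p)"
  shows "(iidE p m f)\<^sup>2 \<le> iidE p m (\<lambda>xs. (f xs)\<^sup>2)"
proof -
  let ?c = "iidE p m f"
  have "0 = iidE p m (\<lambda>_. 0)" by (simp add: iidE_const assms)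
  also have "\<dots> \<le> iidE p m (\<lambda>xs. (f xs - ?c)\<^sup>2)" by (intro iidE_mono) simp
  also have "(\<lambda>xs. (f xs - ?c)\<^sup>2) = (\<lambda>xs. ((f xs)\<^sup>2 - 2 * ?c * f xs) + ?c\<^sup>2)"
    by (auto simp: power2_eq_square algebra_simps)
  also have "iidE p m \<dots> = iidE p m (\<lambda>xs. (f xs)\<^sup>2) - ?c\<^sup>2"
    by (simp add: iidE_add iidE_diff iidE_cmult iidE_const assms power2_eq_square)
  finally show ?thesis by simp
qed

text \<open>The recursion fixes an order of the draws. With explicit product weights on lists,
  exchangeability in \<open>iidE_permute_list\<close> becomes a reindexing.\<close>

lemma iidE_eq_sum_lists:
  assumes "finite (set_pmf p)"
  shows "iidE p m f =
    (\<Sum>xs | set xs \<subseteq> set_pmf p \<and> length xs = m. prod_list (map (pmf p) xs) * f xs)"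
proof (induction m arbitrary: f)
  case 0
  have "{xs. set xs \<subseteq> set_pmf p \<and> length xs = 0} = {[]}" by auto
  then show ?case by simp
next
  case (Suc m)
  let ?L = "\<lambda>m. {xs. set xs \<subseteq> set_pmf p \<and> length xs = m}"
  let ?g = "\<lambda>xs. prod_list (map (pmf p) xs) * f xs"
  have L: "?L (Suc m) = (\<lambda>(x, xs). x # xs) ` (set_pmf p \<times> ?L m)"
    by (auto simp: length_Suc_conv image_iff)
  have "sum ?g (?L (Suc m)) = (\<Sum>(x, xs)\<in>set_pmf p \<times> ?L m. ?g (x # xs))"
    unfolding L by (subst sum.reindex) (auto simp: inj_on_def case_prod_unfold)
  also have "\<dots> = (\<Sum>x\<in>set_pmf p. \<Sum>xs\<in>?L m. ?g (x # xs))"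
    by (rule sum.cartesian_product[symmetric])
  finally show ?case by (simp add: Suc.IH sum_distrib_left mult.assoc)
qed

lemma iidE_permute_list:
  assumes "finite (set_pmf p)" and \<sigma>: "\<sigma> permutes {..<m}"
  shows "iidE p m (\<lambda>xs. f (permute_list \<sigma> xs)) = iidE p m f"
  unfolding iidE_eq_sum_lists[OF assms(1)]
proof (rule sum.reindex_bij_witness[where i = "permute_list (inv \<sigma>)" and j = "permute_list \<sigma>"], goal_cases)
  case (1 xs)
  then show ?case
    using \<sigma> by (simp add: permute_list_compose[symmetric] permutes_inv permutes_inv_o)
next
  case (3 xs)
  then show ?case
    using \<sigma> by (simp add: permute_list_compose[symmetric] permutes_inv permutes_inv_o)
next
  \<comment> \<open>The weight of a list is a product over its entries, so it depends on the
    multiset only.\<close>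
  case (5 xs)
  then have "mset (map (pmf p) (permute_list \<sigma> xs)) = mset (map (pmf p) xs)"
    using \<sigma> by (simp add: mset_map)
  then have "prod_list (map (pmf p) (permute_list \<sigma> xs)) = prod_list (map (pmf p) xs)"
    by (metis prod_mset_prod_list)
  then show ?case by simp
qed (use \<sigma> permutes_inv[OF \<sigma>] in auto)

lemma prob_bind_sample_counts:
  assumes "finite (set_pmf p)"
  shows "measure_pmf.prob (bind_pmf (sample_counts p m) M) {b} =
    iidE p m (\<lambda>xs. pmf (M (count_list xs)) b)"
proof -
  have "pmf (bind_pmf (sample_counts p m) M) b = iidE p m (\<lambda>xs. pmf (M (count_list xs)) b)"
  proof (induction m arbitrary: M)
    case 0
    have "count_list ([] :: nat list) = (\<lambda>_. 0)" by auto
    then show ?case by (simp add: bind_return_pmf)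
  next
    case (Suc m)
    have upd: "count_list (x # xs) = (count_list xs)(x := count_list xs x + 1)" for x :: nat and xs
      by auto
    \<comment> \<open>The last draw is absorbed into the mechanism, which is why \<open>M\<close> is
      generalised in the induction. It reappears as the head of the list; the counts do not see the
      order.\<close>
    have "pmf (bind_pmf (sample_counts p (Suc m)) M) b =
      pmf (bind_pmf (sample_counts p m) (\<lambda>D. bind_pmf p (\<lambda>i. M (D(i := D i + 1))))) b"
      by (simp add: bind_assoc_pmf bind_map_pmf)
    also have "\<dots> = iidE p m (\<lambda>xs. \<Sum>x\<in>set_pmf p. pmf p x * pmf (M (count_list (x # xs))) b)"
      unfolding Suc.IH
      by (intro iidE_cong, subst pmf_bind, subst integral_measure_pmf_real[OF assms])
        (auto simp: mult.commute upd)
    also have "\<dots> = iidE p (Suc m) (\<lambda>xs. pmf (M (count_list xs)) b)"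
      by (simp only: iidE_sum iidE_cmult iidE.simps)
    finally show ?case .
  qed
  then show ?thesis by (simp add: pmf.rep_eq)
qed

text \<open>The usual form resamples one sample; deleting it instead saves the factor two and keeps the
  bound explicit in the counts.\<close>

lemma iidE_Efron_Stein:
  assumes fin: "finite (set_pmf p)"
    and sym: "\<And>xs ys. mset xs = mset ys \<Longrightarrow> f xs = f ys"
  shows "iidE p m (\<lambda>xs. (f xs)\<^sup>2) - (iidE p m f)\<^sup>2 \<le>
    real m * iidE p (m - 1) (\<lambda>xs. \<Sum>x\<in>set_pmf p. pmf p x * (f (x # xs) - f xs)\<^sup>2)"
  using sym
proof (induction m arbitrary: f)
  case 0
  show ?case by simp
next
  case (Suc m)
  let ?E = "iidE p m" and ?S = "set_pmf p"
  define D where "D f = (\<lambda>xs. \<Sum>x\<in>?S. pmf p x * (f (x # xs) - f xs)\<^sup>2)" for f :: "'a list \<Rightarrow> real"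
  let ?h = "\<lambda>x. ?E (\<lambda>xs. f (x # xs))"
  define c where "c = ?E f"
  have IH: "?E (\<lambda>xs. (f (x # xs))\<^sup>2) - (?h x)\<^sup>2 \<le> real m * iidE p (m - 1) (\<lambda>xs. D f (x # xs))" for x
  proof -
    \<comment> \<open>By symmetry the fresh sample moves past the fixed head \<open>x\<close>, so a
      deletion below the head is a deletion from the whole list.\<close>
    have eq: "D (\<lambda>xs. f (x # xs)) = (\<lambda>xs. D f (x # xs))"
      unfolding D_def
    proof (intro ext sum.cong refl)
      fix xs y
      have "f (x # y # xs) = f (y # x # xs)" by (rule Suc.prems) simp
      then show "pmf p y * (f (x # y # xs) - f (x # xs))\<^sup>2 = pmf p y * (f (y # x # xs) - f (x # xs))\<^sup>2"
        by simp
    qed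
    show ?thesis
      unfolding eq[symmetric] unfolding D_def by (rule Suc.IH) (rule Suc.prems, simp)
  qed
  \<comment> \<open>Law of total variance given the first sample: \<open>1\<close> bounds the mean
    conditional variance, \<open>2\<close> the variance of the conditional mean
    \<open>?h\<close>.\<close>
  have 1: "(\<Sum>x\<in>?S. pmf p x * (?E (\<lambda>xs. (f (x # xs))\<^sup>2) - (?h x)\<^sup>2)) \<le> real m * ?E (D f)"
  proof -
    have "(\<Sum>x\<in>?S. pmf p x * (?E (\<lambda>xs. (f (x # xs))\<^sup>2) - (?h x)\<^sup>2)) \<le>
      (\<Sum>x\<in>?S. pmf p x * (real m * iidE p (m - 1) (\<lambda>xs. D f (x # xs))))"
      by (intro sum_mono mult_left_mono IH) simp
    also have "\<dots> = real m * ?E (D f)"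
      by (cases m) (simp_all add: sum_distrib_left algebra_simps)
    finally show ?thesis .
  qed
  \<comment> \<open>Any centre bounds a variance from above. With \<open>c\<close>, the mean over
    one sample fewer, \<open>?h x - c\<close> averages deletion increments and Jensen
    applies.\<close>
  have 2: "(\<Sum>x\<in>?S. pmf p x * (?h x)\<^sup>2) - (\<Sum>x\<in>?S. pmf p x * ?h x)\<^sup>2 \<le> ?E (D f)"
  proof -
    let ?b = "\<Sum>x\<in>?S. pmf p x * ?h x"
    have "(\<Sum>x\<in>?S. pmf p x * (?h x - c)\<^sup>2) =
      (\<Sum>x\<in>?S. pmf p x * (?h x)\<^sup>2) - 2 * c * ?b + c\<^sup>2 * (\<Sum>x\<in>?S. pmf p x)"
      unfolding sum_distrib_left sum_subtractf[symmetric] sum.distrib[symmetric]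
      by (intro sum.cong refl) (simp add: power2_eq_square algebra_simps)
    also have "(\<Sum>x\<in>?S. pmf p x) = 1" by (rule sum_pmf_eq_1) (use fin in auto)
    finally have "(\<Sum>x\<in>?S. pmf p x * (?h x)\<^sup>2) - ?b\<^sup>2 =
      (\<Sum>x\<in>?S. pmf p x * (?h x - c)\<^sup>2) - (?b - c)\<^sup>2"
      by (simp add: power2_eq_square algebra_simps)
    also have "\<dots> \<le> (\<Sum>x\<in>?S. pmf p x * (?h x - c)\<^sup>2)" by simp
    also have "\<dots> \<le> (\<Sum>x\<in>?S. pmf p x * ?E (\<lambda>xs. (f (x # xs) - f xs)\<^sup>2))"
      unfolding c_def iidE_diff[symmetric]
      by (intro sum_mono mult_left_mono iidE_square_le fin) simp
    also have "\<dots> = ?E (D f)" by (simp only: D_def iidE_sum iidE_cmult)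
    finally show ?thesis .
  qed
  show ?case
    using 1 2 unfolding D_def[symmetric]
    by (simp add: right_diff_distrib sum_subtractf algebra_simps)
qed

lemma iidE_count:
  assumes "finite (set_pmf p)"
  shows "iidE p m (\<lambda>xs. real (count_list xs i)) = real m * pmf p i"
proof (induction m)
  case (Suc m)
  have "iidE p (Suc m) (\<lambda>xs. real (count_list xs i)) =
    (\<Sum>x\<in>set_pmf p. pmf p x * (real m * pmf p i + (if x = i then 1 else 0)))"
    unfolding iidE.simps
    by (intro sum.cong refl) (auto simp: iidE_add iidE_const assms Suc.IH)
  also have "\<dots> = (\<Sum>x\<in>set_pmf p. pmf p x) * (real m * pmf p i) +
      (\<Sum>x\<in>set_pmf p. if x = i then pmf p x else 0)"
    by (auto simp: sum_distrib_right sum.distrib[symmetric] distrib_left intro!: sum.cong)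
  also have "\<dots> = real (Suc m) * pmf p i"
    using assms sum_pmf_eq_1[OF assms order_refl]
    by (simp add: sum.delta algebra_simps set_pmf_iff)
  finally show ?case .
qed simp

section \<open>Private mechanisms from statistics of ordered samples\<close>

definition symmetrize :: "nat \<Rightarrow> ('a list \<Rightarrow> real) \<Rightarrow> 'a list \<Rightarrow> real" where
  "symmetrize m f xs = (\<Sum>\<sigma> | \<sigma> permutes {..<m}. f (permute_list \<sigma> xs)) / fact m"

lemma card_permutations_lessThan: "card {\<sigma>. \<sigma> permutes {..<m}} = fact m"
  by (rule card_permutations) auto

text \<open>A permutation taking one list to the other reindexes the sum over all orderings.\<close>

lemma symmetrize_mset_cong:
  assumes "length ys = m" "mset xs = mset ys"
  shows "symmetrize m f xs = symmetrize m f ys"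
proof -
  obtain \<tau> where \<tau>: "\<tau> permutes {..<m}" "permute_list \<tau> ys = xs"
    using assms mset_eq_permutation by metis
  have "(\<Sum>\<sigma> | \<sigma> permutes {..<m}. f (permute_list \<sigma> xs)) =
    (\<Sum>\<sigma> | \<sigma> permutes {..<m}. f (permute_list (\<tau> \<circ> \<sigma>) ys))"
    using \<tau> assms by (intro sum.cong refl) (auto simp: permute_list_compose)
  also have "\<dots> = (\<Sum>\<sigma> | \<sigma> permutes {..<m}. f (permute_list \<sigma> ys))"
    by (rule setum_permutations_compose_left[OF \<tau>(1), symmetric])
  finally show ?thesis by (simp add: symmetrize_def)
qed

text \<open>Independent samples are exchangeable, so symmetrizing costs no accuracy.\<close>

lemma iidE_symmetrize:
  assumes "finite (set_pmf p)"
  shows "iidE p m (symmetrize m f) = iidE p m f"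
proof -
  have "iidE p m (symmetrize m f) =
    iidE p m (\<lambda>xs. (1 / fact m) * (\<Sum>\<sigma> | \<sigma> permutes {..<m}. f (permute_list \<sigma> xs)))"
    by (simp add: symmetrize_def[abs_def])
  also have "\<dots> = (1 / fact m) * (\<Sum>\<sigma> | \<sigma> permutes {..<m}. iidE p m (\<lambda>xs. f (permute_list \<sigma> xs)))"
    by (simp only: iidE_cmult iidE_sum)
  also have "(\<Sum>\<sigma> | \<sigma> permutes {..<m}. iidE p m (\<lambda>xs. f (permute_list \<sigma> xs))) =
    (\<Sum>\<sigma> | \<sigma> permutes {..<m}. iidE p m f)"
    by (intro sum.cong refl iidE_permute_list assms) simp
  finally show ?thesis by (simp add: card_permutations_lessThan)
qed

lemma symmetrize_one_minus: "symmetrize m (\<lambda>xs. 1 - f xs) xs = 1 - symmetrize m f xs"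
  by (simp add: symmetrize_def sum_subtractf card_permutations_lessThan diff_divide_distrib)

lemma symmetrize_nonneg: "(\<And>xs. 0 \<le> f xs) \<Longrightarrow> 0 \<le> symmetrize m f xs"
  by (simp add: symmetrize_def sum_nonneg)

lemma permute_list_update:
  assumes "\<sigma> permutes {..<length xs}"
  shows "permute_list \<sigma> (xs[j := z]) = (permute_list \<sigma> xs)[inv \<sigma> j := z]"
proof (rule nth_equalityI)
  fix i assume "i < length (permute_list \<sigma> (xs[j := z]))"
  then have i: "i < length xs" by simp
  then have "\<sigma> i < length xs" using assms permutes_in_image by fastforce
  moreover have "\<sigma> i = j \<longleftrightarrow> i = inv \<sigma> j" using assms by (metis permutes_inverses)
  ultimately show "permute_list \<sigma> (xs[j := z]) ! i = (permute_list \<sigma> xs)[inv \<sigma> j := z] ! i"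
    using i assms by (auto simp: permute_list_nth nth_list_update)
qed simp

text \<open>Under every ordering the replacement hits the single position
  \<open>inv \<sigma> j\<close>; a factor uniform in position and value therefore survives the
  average.\<close>

lemma symmetrize_update_le:
  assumes "\<And>xs j z. length xs = m \<Longrightarrow> f (xs[j := z]) \<le> c * f xs" "length xs = m"
  shows "symmetrize m f (xs[j := z]) \<le> c * symmetrize m f xs"
proof -
  have "(\<Sum>\<sigma> | \<sigma> permutes {..<m}. f (permute_list \<sigma> (xs[j := z]))) \<le>
    (\<Sum>\<sigma> | \<sigma> permutes {..<m}. c * f (permute_list \<sigma> xs))"
    using assms by (intro sum_mono) (auto simp: permute_list_update)
  then show ?thesis
    by (simp add: symmetrize_def divide_right_mono flip: sum_distrib_left)
qed

section \<open>Datasets as lists of fixed length\<close>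

definition dataset_list :: "nat \<Rightarrow> (nat \<Rightarrow> nat) \<Rightarrow> nat list" where
  "dataset_list n D = concat (map (\<lambda>i. replicate (D i) i) [1..<Suc n])"

text \<open>A dataset of the wrong size is brought to size \<^term>\<open>m\<close> so that adding or removing one
  sample amounts to replacing at most one element of the result.\<close>

definition resized_list :: "nat \<Rightarrow> nat \<Rightarrow> (nat \<Rightarrow> nat) \<Rightarrow> nat list" where
  "resized_list n m D = take m (dataset_list n D @ replicate m 1)"

lemma length_resized_list [simp]: "length (resized_list n m D) = m"
  by (simp add: resized_list_def)

lemma mset_dataset_list:
  assumes "set xs \<subseteq> {1..n}"
  shows "mset (dataset_list n (count_list xs)) = mset xs"
proof (rule multiset_eqI)
  fix i
  have "count (mset (concat (map (\<lambda>i. replicate (D i) i) is))) j =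
    (\<Sum>i\<leftarrow>is. if i = j then D i else 0)" for D :: "nat \<Rightarrow> nat" and "is" j
    by (induction "is") auto
  then have "count (mset (dataset_list n (count_list xs))) i =
    (\<Sum>k\<leftarrow>[1..<Suc n]. if k = i then count_list xs k else 0)"
    unfolding dataset_list_def .
  also have "\<dots> = (\<Sum>k\<in>{1..<Suc n}. if k = i then count_list xs k else 0)"
    by (simp only: interv_sum_list_conv_sum_set_nat set_upt)
  also have "\<dots> = count_list xs i"
    using assms by (auto simp: count_list_0_iff)
  finally show "count (mset (dataset_list n (count_list xs))) i = count (mset xs) i"
    by (simp add: count_mset)
qed

lemma mset_resized_list:
  assumes "set xs \<subseteq> {1..n}" "length xs = m"
  shows "mset (resized_list n m (count_list xs)) = mset xs"
proof -
  have "length (dataset_list n (count_list xs)) = m"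
    using mset_dataset_list[OF assms(1)] assms(2) mset_eq_length by metis
  then show ?thesis by (simp add: resized_list_def mset_dataset_list[OF assms(1)])
qed

text \<open>The extra \<open>i\<close> sits right after \<open>a\<close>. Either truncation removes
  it and the lists agree, or it pushes out the entry \<open>b ! r\<close>, and overwriting
  \<open>i\<close> by that entry restores the multiset.\<close>

lemma resized_list_add_one:
  assumes i: "i \<in> {1..n}" and D': "D' i = Suc (D i)" "\<And>k. k \<in> {1..n} \<Longrightarrow> k \<noteq> i \<Longrightarrow> D' k = D k"
  shows "\<exists>j z. mset (resized_list n m D) = mset ((resized_list n m D')[j := z])"
proof -
  let ?L = "\<lambda>D is. concat (map (\<lambda>i. replicate (D i) i) is) :: nat list"
  define a where "a = ?L D [1..<i] @ replicate (D i) i"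
  define b where "b = ?L D [Suc i..<Suc n] @ replicate m 1"
  have split: "[1..<Suc n] = [1..<i] @ i # [Suc i..<Suc n]"
    using i upt_add_eq_append[of 1 i "Suc n - i"] upt_conv_Cons[of i "Suc n"] by (simp del: upt_Suc)
  have D: "dataset_list n D @ replicate m 1 = a @ b"
    unfolding dataset_list_def split a_def b_def by simp
  have m1: "map (\<lambda>i. replicate (D' i) i) [1..<i] = map (\<lambda>i. replicate (D i) i) [1..<i]"
    and m2: "map (\<lambda>i. replicate (D' i) i) [Suc i..<Suc n] = map (\<lambda>i. replicate (D i) i) [Suc i..<Suc n]"
    using i D'(2) by (auto simp del: upt_Suc)
  have "dataset_list n D' @ replicate m 1 = ?L D [1..<i] @ replicate (Suc (D i)) i @ b"
    unfolding dataset_list_def split b_def map_append concat_append list.map concat.simps m1 m2 D'(1)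
    by (simp del: upt_Suc replicate_Suc)
  then have D2: "dataset_list n D' @ replicate m 1 = a @ i # b"
    by (simp add: a_def replicate_append_same)
  show ?thesis
  proof (cases "length a < m")
    case False
    \<comment> \<open>Position \<open>m\<close> is out of range, so this update changes nothing and
      merely supplies witnesses.\<close>
    then have "resized_list n m D = (resized_list n m D')[m := 0]"
      unfolding resized_list_def D D2 by (simp add: list_update_beyond)
    then have "mset (resized_list n m D) = mset ((resized_list n m D')[m := 0])"
      by (rule arg_cong)
    then show ?thesis by (intro exI)
  next
    case True
    \<comment> \<open>The \<open>m\<close> padding ones at the end of \<open>b\<close> ensure that
      \<open>b ! r\<close> exists.\<close>
    define r where "r = m - Suc (length a)"
    have r: "m - length a = Suc r" "r < length b"
      using True by (auto simp: r_def b_def)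
    have "mset (resized_list n m D) = mset (a @ take r b @ [b ! r])"
      unfolding resized_list_def D using True r by (simp add: take_Suc_conv_app_nth)
    also have "\<dots> = mset ((a @ i # take r b)[length a := b ! r])" by simp
    also have "a @ i # take r b = resized_list n m D'"
      unfolding resized_list_def D2 using True r by simp
    finally show ?thesis by (intro exI)
  qed
qed

text \<open>Counts are integers, so one differing coordinate exhausts the distance.\<close>

lemma l1_dist_le_1_cases:
  assumes "l1_dist n D D' \<le> 1"
  obtains (eq) "\<And>k. k \<in> {1..n} \<Longrightarrow> D' k = D k"
  | (add) i where "i \<in> {1..n}" "D' i = Suc (D i)" "\<And>k. k \<in> {1..n} \<Longrightarrow> k \<noteq> i \<Longrightarrow> D' k = D k"
  | (remove) i where "i \<in> {1..n}" "D i = Suc (D' i)" "\<And>k. k \<in> {1..n} \<Longrightarrow> k \<noteq> i \<Longrightarrow> D k = D' k"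
proof (cases "\<forall>k\<in>{1..n}. D' k = D k")
  case True
  then show ?thesis using eq by blast
next
  case False
  then obtain i where i: "i \<in> {1..n}" "D' i \<noteq> D i" by blast
  have "l1_dist n D D' = \<bar>real (D i) - real (D' i)\<bar> + (\<Sum>k\<in>{1..n} - {i}. \<bar>real (D k) - real (D' k)\<bar>)"
    unfolding l1_dist_def using i by (subst sum.remove[of _ i]) auto
  moreover have "\<bar>real (D i) - real (D' i)\<bar> \<ge> 1" using i by linarith
  moreover have "(\<Sum>k\<in>{1..n} - {i}. \<bar>real (D k) - real (D' k)\<bar>) \<ge> 0" by (intro sum_nonneg) auto
  ultimately have 1: "\<bar>real (D i) - real (D' i)\<bar> = 1"
    and "(\<Sum>k\<in>{1..n} - {i}. \<bar>real (D k) - real (D' k)\<bar>) = 0"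
    using assms by linarith+
  then have 0: "\<forall>k\<in>{1..n} - {i}. \<bar>real (D k) - real (D' k)\<bar> = 0"
    by (subst (asm) sum_nonneg_eq_0_iff) auto
  from 1 have "D' i = Suc (D i) \<or> D i = Suc (D' i)" by linarith
  then show ?thesis using 0 i add[of i] remove[of i] by auto
qed

lemma resized_list_neighbours:
  assumes "l1_dist n D D' \<le> 1"
  shows "\<exists>xs j z. length xs = m \<and> mset (resized_list n m D) = mset xs \<and>
    mset (resized_list n m D') = mset (xs[j := z])"
  using assms
proof (cases rule: l1_dist_le_1_cases)
  case eq
  then have "map (\<lambda>i. replicate (D' i) i) [1..<Suc n] = map (\<lambda>i. replicate (D i) i) [1..<Suc n]"
    by (auto simp del: upt_Suc)
  then have "resized_list n m D' = resized_list n m D"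
    by (simp only: resized_list_def dataset_list_def)
  then have "mset (resized_list n m D') = mset ((resized_list n m D)[m := 0])"
    by (simp add: list_update_beyond)
  then have "length (resized_list n m D) = m \<and>
    mset (resized_list n m D) = mset (resized_list n m D) \<and>
    mset (resized_list n m D') = mset ((resized_list n m D)[m := 0])" by simp
  then show ?thesis by (intro exI)
next
  case (add i)
  obtain j z where "mset (resized_list n m D) = mset ((resized_list n m D')[j := z])"
    using resized_list_add_one[of i n D' D m, OF add] by blast
  \<comment> \<open>The updated list is taken as the base; writing back the old entry at
    \<open>j\<close> leads to the list of \<open>D'\<close>.\<close>
  then have "length ((resized_list n m D')[j := z]) = m \<and>
    mset (resized_list n m D) = mset ((resized_list n m D')[j := z]) \<and>
    mset (resized_list n m D') = mset ((resized_list n m D')[j := z, j := resized_list n m D' ! j])"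
    by simp
  then show ?thesis by (intro exI)
next
  case (remove i)
  obtain j z where "mset (resized_list n m D') = mset ((resized_list n m D)[j := z])"
    using resized_list_add_one[of i n D D' m, OF remove] by blast
  then have "length (resized_list n m D) = m \<and>
    mset (resized_list n m D) = mset (resized_list n m D) \<and>
    mset (resized_list n m D') = mset ((resized_list n m D)[j := z])" by simp
  then show ?thesis by (intro exI)
qed

text \<open>Here \<open>f\<close> is the probability of \<open>True\<close> on an ordered sample.
  With two outcomes, bounding both \<open>f\<close> and \<open>1 - f\<close> settles pure privacy.
  Symmetrizing makes the answer depend on the counts only, and resizing covers datasets of any size,
  while the output law on \<open>m\<close> independent samples stays the same.\<close>

lemma diff_private_mechanism_of_list_statistic:
  fixes f :: "nat list \<Rightarrow> real"
  assumes f01: "\<And>xs. 0 \<le> f xs" "\<And>xs. f xs \<le> 1"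
    and upd: "\<And>xs j z. length xs = m \<Longrightarrow> f (xs[j := z]) \<le> exp \<epsilon> * f xs"
      "\<And>xs j z. length xs = m \<Longrightarrow> 1 - f (xs[j := z]) \<le> exp \<epsilon> * (1 - f xs)"
  shows "\<exists>M. diff_private n \<epsilon> 0 M \<and> (\<forall>p. is_dist_on n p \<longrightarrow>
    measure_pmf.prob (bind_pmf (sample_counts p m) M) {True} = iidE p m f \<and>
    measure_pmf.prob (bind_pmf (sample_counts p m) M) {False} = iidE p m (\<lambda>xs. 1 - f xs))"
proof -
  define g where "g D = symmetrize m f (resized_list n m D)" for D
  define M where "M D = bernoulli_pmf (g D)" for D
  have g_minus: "1 - g D = symmetrize m (\<lambda>xs. 1 - f xs) (resized_list n m D)" for D
    by (simp add: g_def symmetrize_one_minus)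
  have g01: "0 \<le> g D" "g D \<le> 1" for D
  proof -
    show "0 \<le> g D" unfolding g_def by (intro symmetrize_nonneg f01)
    have "0 \<le> 1 - g D" unfolding g_minus by (intro symmetrize_nonneg) (simp add: f01)
    then show "g D \<le> 1" by simp
  qed
  have pmfM: "pmf (M D) b = (if b then g D else 1 - g D)" for D b
    using g01[of D] by (cases b) (simp_all add: M_def)
  have "diff_private n \<epsilon> 0 M"
    unfolding diff_private_def
  proof (intro allI impI, elim conjE)
    fix D D' :: "nat \<Rightarrow> nat" and S :: "bool set"
    assume "l1_dist n D D' \<le> 1"
    \<comment> \<open>The bound is needed for \<open>D\<close> in terms of \<open>D'\<close>, so the
      list of \<open>D'\<close> serves as the base and that of \<open>D\<close> as its
      update.\<close>
    then have "l1_dist n D' D \<le> 1" by (simp add: l1_dist_def abs_minus_commute)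
    from resized_list_neighbours[OF this, of m] obtain xs j z
      where xs: "length xs = m" "mset (resized_list n m D') = mset xs"
        "mset (resized_list n m D) = mset (xs[j := z])" by blast
    have sym: "symmetrize m h (resized_list n m D) = symmetrize m h (xs[j := z])"
      "symmetrize m h (resized_list n m D') = symmetrize m h xs" for h
      using xs by (intro symmetrize_mset_cong; simp)+
    have "g D \<le> exp \<epsilon> * g D'" "1 - g D \<le> exp \<epsilon> * (1 - g D')"
      unfolding g_minus unfolding g_def sym
      by (intro symmetrize_update_le xs(1) upd; assumption)+
    then have "pmf (M D) b \<le> exp \<epsilon> * pmf (M D') b" for b
      by (cases b) (simp_all add: pmfM)
    then have "(\<Sum>b\<in>S. pmf (M D) b) \<le> (\<Sum>b\<in>S. exp \<epsilon> * pmf (M D') b)"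
      by (intro sum_mono)
    then show "measure_pmf.prob (M D) S \<le> exp \<epsilon> * measure_pmf.prob (M D') S + 0"
      by (simp add: measure_measure_pmf_finite sum_distrib_left)
  qed
  moreover have "measure_pmf.prob (bind_pmf (sample_counts p m) M) {True} = iidE p m f \<and>
    measure_pmf.prob (bind_pmf (sample_counts p m) M) {False} = iidE p m (\<lambda>xs. 1 - f xs)"
    if p: "is_dist_on n p" for p
  proof -
    have fin: "finite (set_pmf p)" using p finite_subset by (auto simp: is_dist_on_def)
    have g: "g (count_list xs) = symmetrize m f xs" if "length xs = m" "set xs \<subseteq> set_pmf p" for xs
      unfolding g_def using that p
      by (intro symmetrize_mset_cong mset_resized_list) (auto simp: is_dist_on_def)
    have "iidE p m (\<lambda>xs. pmf (M (count_list xs)) True) = iidE p m f"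
      unfolding iidE_symmetrize[OF fin, of m f, symmetric] by (intro iidE_cong) (simp add: pmfM g)
    moreover have "iidE p m (\<lambda>xs. pmf (M (count_list xs)) False) = iidE p m (\<lambda>xs. 1 - f xs)"
      unfolding iidE_symmetrize[OF fin, of m "\<lambda>xs. 1 - f xs", symmetric]
      by (intro iidE_cong) (simp add: pmfM g symmetrize_one_minus)
    ultimately show ?thesis by (simp add: prob_bind_sample_counts fin)
  qed
  ultimately show ?thesis by blast
qed

section \<open>Amplification over independent batches\<close>

primrec batch_sum :: "nat \<Rightarrow> ('a list \<Rightarrow> real) \<Rightarrow> nat \<Rightarrow> 'a list \<Rightarrow> real" where
  "batch_sum b V 0 zs = 0"
| "batch_sum b V (Suc k) zs = V (take b zs) + batch_sum b V k (drop b zs)"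

lemma batch_sum_update:
  assumes "\<And>xs j z. length xs = b \<Longrightarrow> \<bar>V (xs[j := z]) - V xs\<bar> \<le> \<epsilon>" "0 \<le> \<epsilon>" "length zs = k * b"
  shows "\<bar>batch_sum b V k (zs[j := z]) - batch_sum b V k zs\<bar> \<le> \<epsilon>"
  using assms(3)
proof (induction k arbitrary: zs j)
  case 0
  then show ?case using assms(2) by simp
next
  case (Suc k)
  show ?case
  proof (cases "j < b")
    case True
    then have "drop b (zs[j := z]) = drop b zs" "take b (zs[j := z]) = (take b zs)[j := z]"
      by (simp_all add: take_update_swap)
    then show ?thesis using assms(1)[of "take b zs" j z] Suc.prems by simp
  next
    case False
    then have "drop b (zs[j := z]) = (drop b zs)[j - b := z]" "take b (zs[j := z]) = take b zs"
      by (simp_all add: drop_update_swap)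
    then show ?thesis using Suc.IH[of "drop b zs" "j - b"] Suc.prems by simp
  qed
qed

text \<open>Disjoint batches are independent, so the exponential moment factorises.\<close>

lemma iidE_exp_batch_sum:
  "iidE p (k * b) (\<lambda>zs. exp (c * batch_sum b V k zs)) = iidE p b (\<lambda>xs. exp (c * V xs)) ^ k"
proof (induction k)
  case (Suc k)
  have "iidE p (Suc k * b) (\<lambda>zs. exp (c * batch_sum b V (Suc k) zs)) =
    iidE p b (\<lambda>xs. iidE p (k * b) (\<lambda>ys. exp (c * batch_sum b V (Suc k) (xs @ ys))))"
    by (simp only: mult_Suc iidE_append)
  also have "\<dots> = iidE p b (\<lambda>xs. iidE p (k * b) (\<lambda>ys. exp (c * V xs) * exp (c * batch_sum b V k ys)))"
    by (intro iidE_cong) (simp add: distrib_left exp_add)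
  also have "\<dots> = iidE p b (\<lambda>xs. exp (c * V xs) * iidE p b (\<lambda>xs. exp (c * V xs)) ^ k)"
    by (simp only: iidE_cmult Suc.IH)
  also have "\<dots> = iidE p b (\<lambda>xs. exp (c * V xs)) ^ Suc k"
    by (simp add: iidE_cmult mult.commute[of "exp _"] mult.commute[of "iidE p b _"])
  finally show ?case .
qed simp

text \<open>On the unit interval \<open>exp v \<le> 1 + v + v\<^sup>2 \<le> 1 + 2 * v\<close>, so a
  mean of at most 1/8 gives at most \<open>1 + 1 / 4\<close>.\<close>

lemma iidE_exp_le_of_small_mean:
  assumes fin: "finite (set_pmf p)" and V: "\<And>xs. 0 \<le> V xs" "\<And>xs. V xs \<le> 1" and "iidE p b V \<le> 1 / 8"
  shows "iidE p b (\<lambda>xs. exp (V xs)) \<le> exp (1 / 4)"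
proof -
  have "exp (V xs) \<le> 1 + 2 * V xs" for xs
  proof -
    have "exp (V xs) \<le> 1 + V xs + (V xs)\<^sup>2" using V by (intro exp_bound)
    also have "(V xs)\<^sup>2 \<le> V xs" using V[of xs] by (simp add: power2_eq_square mult_left_le)
    finally show ?thesis by simp
  qed
  then have "iidE p b (\<lambda>xs. exp (V xs)) \<le> iidE p b (\<lambda>xs. 1 + 2 * V xs)" by (intro iidE_mono)
  also have "\<dots> = 1 + 2 * iidE p b V" by (simp add: iidE_add iidE_cmult iidE_const fin)
  also have "\<dots> \<le> 1 + 1 / 4" using assms(4) by simp
  also have "\<dots> \<le> exp (1 / 4)" by (rule exp_ge_add_one_self)
  finally show ?thesis .
qed

text \<open>This converts bounded sensitivity of the log-odds into pure differential
  privacy.\<close>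

lemma logistic_lipschitz:
  fixes a b \<epsilon> :: real
  assumes "a \<le> b + \<epsilon>" "0 \<le> \<epsilon>"
  shows "1 / (1 + exp b) \<le> exp \<epsilon> * (1 / (1 + exp a))"
proof -
  have "exp a \<le> exp \<epsilon> * exp b" using assms by (simp flip: exp_add)
  moreover have "1 \<le> exp \<epsilon>" using assms by simp
  ultimately have "1 + exp a \<le> exp \<epsilon> * (1 + exp b)" unfolding distrib_left by linarith
  moreover have "0 < 1 + exp a" "0 < 1 + exp b" by (simp_all add: add_pos_pos)
  ultimately show ?thesis by (simp add: field_simps)
qed

text \<open>The answer is drawn with log-odds equal to the centred sum of the batch statistics. A single
  sample influences one batch only, so the privacy loss does not grow with the number of batches.\<close>

lemma diff_private_amplification:
  fixes V :: "nat list \<Rightarrow> real"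
  assumes V: "\<And>xs. 0 \<le> V xs" "\<And>xs. V xs \<le> 1" and "0 \<le> \<epsilon>"
    and upd: "\<And>xs j z. length xs = b \<Longrightarrow> \<bar>V (xs[j := z]) - V xs\<bar> \<le> \<epsilon>"
  shows "\<exists>M. diff_private n \<epsilon> 0 M \<and> (\<forall>p. is_dist_on n p \<longrightarrow>
    (iidE p b V \<le> 1 / 8 \<longrightarrow>
      measure_pmf.prob (bind_pmf (sample_counts p (k * b)) M) {True} \<ge> 1 - exp (- real k / 4)) \<and>
    (iidE p b (\<lambda>xs. 1 - V xs) \<le> 1 / 8 \<longrightarrow>
      measure_pmf.prob (bind_pmf (sample_counts p (k * b)) M) {False} \<ge> 1 - exp (- real k / 4)))"
proof -
  define Y where "Y = batch_sum b V k"
  define f where "f zs = 1 / (1 + exp (Y zs - k / 2))" for zs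
  have pos: "0 < 1 + exp x" for x :: real by (simp add: add_pos_pos)
  \<comment> \<open>The complement reverses the log-odds, so the same Lipschitz bound serves both
    outcomes.\<close>
  have f_minus: "1 - f zs = 1 / (1 + exp (k / 2 - Y zs))" for zs
    unfolding f_def using pos[of "Y zs - k / 2"] pos[of "k / 2 - Y zs"]
    by (simp add: field_simps flip: exp_add)
  have f01: "0 \<le> f zs" "f zs \<le> 1" for zs
    unfolding f_def using pos[of "Y zs - k / 2"] by simp_all
  have Yupd: "\<bar>Y (zs[j := z]) - Y zs\<bar> \<le> \<epsilon>" if "length zs = k * b" for zs j z
    unfolding Y_def using that upd assms(3) by (intro batch_sum_update)
  have "f (zs[j := z]) \<le> exp \<epsilon> * f zs" "1 - f (zs[j := z]) \<le> exp \<epsilon> * (1 - f zs)"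
    if "length zs = k * b" for zs j z
    unfolding f_minus unfolding f_def using Yupd[OF that, of j z] assms(3)
    by (intro logistic_lipschitz; linarith)+
  then obtain M where M: "diff_private n \<epsilon> 0 M"
    "\<And>p. is_dist_on n p \<Longrightarrow> measure_pmf.prob (bind_pmf (sample_counts p (k * b)) M) {True} = iidE p (k * b) f"
    "\<And>p. is_dist_on n p \<Longrightarrow>
      measure_pmf.prob (bind_pmf (sample_counts p (k * b)) M) {False} = iidE p (k * b) (\<lambda>xs. 1 - f xs)"
    using diff_private_mechanism_of_list_statistic[of f "k * b" \<epsilon> n] f01 by metis
  have logistic_le: "1 / (1 + exp x) \<le> exp (- x)" for x :: real
    using pos[of x] by (simp add: field_simps exp_minus)
  \<comment> \<open>Chernoff bound including the randomness of the answer: the logistic function is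
    at most an exponential, so the error probability is directly bounded by an exponential moment.
    Centring contributes the exponent \<open>- k / 2\<close>, the batches
    \<open>k / 4\<close>.\<close>
  have null: "iidE p (k * b) f \<ge> 1 - exp (- real k / 4)"
    if "finite (set_pmf p)" "iidE p b V \<le> 1 / 8" for p
  proof -
    have "1 - iidE p (k * b) f = iidE p (k * b) (\<lambda>zs. 1 - f zs)"
      by (simp add: iidE_diff iidE_const that)
    also have "\<dots> \<le> iidE p (k * b) (\<lambda>zs. exp (- real k / 2) * exp (1 * Y zs))"
      unfolding f_minus
      by (intro iidE_mono order_trans[OF logistic_le]) (simp flip: exp_add)
    also have "\<dots> = exp (- real k / 2) * iidE p b (\<lambda>xs. exp (V xs)) ^ k"
      unfolding iidE_cmult Y_def iidE_exp_batch_sum by simp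
    also have "\<dots> \<le> exp (- real k / 2) * exp (1 / 4) ^ k"
    proof (intro mult_left_mono power_mono iidE_exp_le_of_small_mean that V)
      have "iidE p b (\<lambda>_. 0) \<le> iidE p b (\<lambda>xs. exp (V xs))" by (intro iidE_mono) simp
      then show "0 \<le> iidE p b (\<lambda>xs. exp (V xs))" by (simp add: iidE_const that)
    qed simp
    also have "\<dots> = exp (- real k / 4)" by (simp flip: exp_of_nat_mult exp_add)
    finally show ?thesis by simp
  qed
  have alt: "iidE p (k * b) (\<lambda>zs. 1 - f zs) \<ge> 1 - exp (- real k / 4)"
    if "finite (set_pmf p)" "iidE p b (\<lambda>xs. 1 - V xs) \<le> 1 / 8" for p
  proof -
    have "1 - iidE p (k * b) (\<lambda>zs. 1 - f zs) = iidE p (k * b) f"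
      by (simp add: iidE_diff iidE_const that)
    also have "\<dots> \<le> iidE p (k * b) (\<lambda>zs. exp (real k / 2) * exp (- 1 * Y zs))"
      unfolding f_def
      by (intro iidE_mono order_trans[OF logistic_le]) (simp flip: exp_add)
    also have "\<dots> = exp (real k / 2) * iidE p b (\<lambda>xs. exp (- V xs)) ^ k"
      unfolding iidE_cmult Y_def iidE_exp_batch_sum by simp
    \<comment> \<open>Shifting by 1 puts \<open>1 - V\<close> in the role of \<open>V\<close>; the
      exponents \<open>k / 2 - k + k / 4\<close> add up to \<open>- k / 4\<close>.\<close>
    also have "(\<lambda>xs. exp (- V xs)) = (\<lambda>xs. exp (- 1) * exp (1 - V xs))"
      by (simp flip: exp_add)
    also have "exp (real k / 2) * iidE p b \<dots> ^ k \<le> exp (real k / 2) * (exp (- 1) * exp (1 / 4)) ^ k"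
      unfolding iidE_cmult
    proof (intro mult_left_mono power_mono iidE_exp_le_of_small_mean that)
      have "iidE p b (\<lambda>_. 0) \<le> iidE p b (\<lambda>xs. exp (1 - V xs))" by (intro iidE_mono) simp
      then show "0 \<le> exp (- 1) * iidE p b (\<lambda>xs. exp (1 - V xs))" by (simp add: iidE_const that)
    qed (use V in simp_all)
    also have "\<dots> = exp (- real k / 4)" by (simp flip: exp_of_nat_mult exp_add)
    finally show ?thesis by simp
  qed
  have "finite (set_pmf p)" if "is_dist_on n p" for p
    using that finite_subset by (auto simp: is_dist_on_def)
  with M null alt show ?thesis by (intro exI[of _ M]) auto
qed

section \<open>The clipped bilinear statistic\<close>

definition clip :: "real \<Rightarrow> real \<Rightarrow> real" where
  "clip t x = max (- t) (min t x)"

lemma clip_abs_le: "0 \<le> t \<Longrightarrow> \<bar>clip t x\<bar> \<le> t"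
  by (auto simp: clip_def)

lemma clip_lipschitz: "\<bar>clip t x - clip t y\<bar> \<le> \<bar>x - y\<bar>"
  by (auto simp: clip_def max_def min_def)

lemma clip_square_le: "0 \<le> t \<Longrightarrow> (clip t x)\<^sup>2 \<le> x\<^sup>2" "0 \<le> t \<Longrightarrow> (clip t x)\<^sup>2 \<le> t\<^sup>2"
  by (auto simp: clip_def max_def min_def abs_le_square_iff[symmetric])

lemma clip_increment_square_le: "(clip t (x + 1) - clip t x)\<^sup>2 \<le> 1"
  using clip_lipschitz[of t "x + 1" x] by (simp add: abs_square_le_1)

text \<open>Past the threshold the loss is at most \<open>y - t / 2\<close> with
  \<open>y = \<bar>x - d\<bar>\<close>, and \<open>(y - t)\<^sup>2 \<ge> 0\<close> makes this
  quadratic in \<open>y\<close>. In the mean, the clipping bias is thus controlled by a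
  variance.\<close>

lemma clip_near:
  assumes "0 < t" "\<bar>d\<bar> \<le> t / 2"
  shows "\<bar>clip t x - x\<bar> \<le> (x - d)\<^sup>2 / (2 * t)"
proof (cases "\<bar>x\<bar> \<le> t")
  case True
  then show ?thesis using assms by (simp add: clip_def)
next
  case False
  define y where "y = \<bar>x - d\<bar>"
  have "\<bar>clip t x - x\<bar> \<le> y - t / 2"
    using False assms by (auto simp: clip_def y_def max_def min_def abs_if split: if_splits)
  also have "\<dots> \<le> y\<^sup>2 / (2 * t)"
  proof -
    have "0 \<le> (y - t)\<^sup>2" by simp
    then show ?thesis using assms by (simp add: field_simps power2_eq_square)
  qed
  finally show ?thesis by (simp add: y_def)
qed

text \<open>Either \<open>x\<close> is within \<open>\<bar>d\<bar> / 2\<close> of \<open>d\<close>,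
  so it has the sign of \<open>d\<close> and at least half its size, or the quotient is at least
  1/4. In the latter case the subtracted \<open>3 / 2 * t\<close> covers both the worst value
  \<open>- t\<close> and the claimed gain of at most \<open>t / 2\<close>.\<close>

lemma clip_far:
  assumes "0 < t" "t / 2 < \<bar>d\<bar>"
  shows "min \<bar>d\<bar> t / 2 - 6 * t * ((x - d)\<^sup>2 / d\<^sup>2) \<le> sgn d * clip t x"
proof (cases "\<bar>x - d\<bar> < \<bar>d\<bar> / 2")
  case True
  then have "min \<bar>d\<bar> t / 2 \<le> sgn d * clip t x"
    using assms by (auto simp: clip_def max_def min_def sgn_if abs_if split: if_splits)
  moreover have "0 \<le> 6 * t * ((x - d)\<^sup>2 / d\<^sup>2)" using assms by simp
  ultimately show ?thesis by linarith
next
  case False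
  then have "(\<bar>d\<bar> / 2)\<^sup>2 \<le> \<bar>x - d\<bar>\<^sup>2" by (intro power_mono) auto
  moreover have "0 < d\<^sup>2" using assms by auto
  ultimately have "1 / 4 \<le> (x - d)\<^sup>2 / d\<^sup>2" by (simp add: pos_le_divide_eq power_divide)
  then have "6 * t * (1 / 4) \<le> 6 * t * ((x - d)\<^sup>2 / d\<^sup>2)" using assms by (intro mult_left_mono) auto
  moreover have "- t \<le> sgn d * clip t x" using clip_abs_le[of t x] assms by (auto simp: sgn_if)
  moreover have "min \<bar>d\<bar> t \<le> t" by simp
  ultimately show ?thesis by linarith
qed

text \<open>The increment vanishes once \<open>t \<le> x\<close>; below that,
  \<open>2 * t < d\<close> forces a deviation larger than \<open>d / 2\<close>.\<close>

lemma clip_increment_far: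
  assumes "0 < t" "2 * t < d"
  shows "(clip t (x + 1) - clip t x)\<^sup>2 \<le> 4 * ((x - d)\<^sup>2 / d\<^sup>2)"
proof (cases "t \<le> x")
  case True
  then show ?thesis using assms by (simp add: clip_def)
next
  case False
  then have "(d / 2)\<^sup>2 \<le> \<bar>x - d\<bar>\<^sup>2" using assms by (intro power_mono) auto
  then have "1 \<le> 4 * ((x - d)\<^sup>2 / d\<^sup>2)" using assms by (simp add: field_simps power2_eq_square)
  then show ?thesis using clip_increment_square_le[of t x] by linarith
qed

lemma iidE_abs_le:
  assumes "\<And>xs. \<bar>f xs\<bar> \<le> g xs"
  shows "\<bar>iidE p m f\<bar> \<le> iidE p m g"
proof -
  have "iidE p m f \<le> iidE p m g" using assms by (intro iidE_mono) (simp add: abs_le_iff)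
  moreover have "iidE p m (\<lambda>xs. - 1 * f xs) \<le> iidE p m g"
    using assms by (intro iidE_mono) (simp add: abs_le_iff)
  ultimately show ?thesis unfolding iidE_cmult by linarith
qed

text \<open>Deleting a sample changes the count by an indicator, so Efron-Stein gives this
  Poisson-type bound.\<close>

lemma iidE_count_variance:
  assumes fin: "finite (set_pmf p)"
  shows "iidE p m (\<lambda>xs. (real (count_list xs i) - real m * pmf p i)\<^sup>2) \<le> real m * pmf p i"
proof -
  let ?N = "\<lambda>xs. real (count_list xs i)" and ?\<mu> = "real m * pmf p i"
  have "iidE p m (\<lambda>xs. (?N xs - ?\<mu>)\<^sup>2) = iidE p m (\<lambda>xs. ((?N xs)\<^sup>2 - 2 * ?\<mu> * ?N xs) + ?\<mu>\<^sup>2)"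
    by (intro iidE_cong) (simp add: power2_eq_square algebra_simps)
  also have "\<dots> = iidE p m (\<lambda>xs. (?N xs)\<^sup>2) - (iidE p m ?N)\<^sup>2"
    unfolding iidE_add iidE_diff iidE_cmult iidE_const[OF fin] iidE_count[OF fin]
    by (simp add: power2_eq_square)
  also have "\<dots> \<le> real m * iidE p (m - 1) (\<lambda>xs. \<Sum>x\<in>set_pmf p. pmf p x * (?N (x # xs) - ?N xs)\<^sup>2)"
    by (intro iidE_Efron_Stein fin) (metis count_mset)
  also have "(\<lambda>xs. \<Sum>x\<in>set_pmf p. pmf p x * (?N (x # xs) - ?N xs)\<^sup>2) = (\<lambda>_. pmf p i)"
  proof
    fix xs
    have "(\<Sum>x\<in>set_pmf p. pmf p x * (?N (x # xs) - ?N xs)\<^sup>2) = (\<Sum>x\<in>set_pmf p. if x = i then pmf p i else 0)"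
      by (intro sum.cong) auto
    then show "(\<Sum>x\<in>set_pmf p. pmf p x * (?N (x # xs) - ?N xs)\<^sup>2) = pmf p i"
      using fin by (simp add: set_pmf_iff)
  qed
  finally show ?thesis by (simp add: iidE_const fin)
qed

text \<open>\<open>clip_slope\<close> averages over \<open>m - 1\<close> samples while the centre
  stays at \<open>m\<close> times the mass; the shift adds only
  \<open>(pmf p i)\<^sup>2 \<le> pmf p i\<close>.\<close>

lemma iidE_count_deviation_pred:
  assumes fin: "finite (set_pmf p)" and "1 \<le> m"
  shows "iidE p (m - 1) (\<lambda>xs. (real (count_list xs i) - real m * pmf p i)\<^sup>2) \<le> real m * pmf p i"
proof -
  let ?N = "\<lambda>xs. real (count_list xs i)" and ?\<mu> = "real (m - 1) * pmf p i"
  have m: "real m = real (m - 1) + 1" using assms(2) by simp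
  have "iidE p (m - 1) (\<lambda>xs. (?N xs - real m * pmf p i)\<^sup>2) =
    iidE p (m - 1) (\<lambda>xs. (?N xs - ?\<mu>)\<^sup>2 + ((pmf p i)\<^sup>2 + 2 * pmf p i * ?\<mu>) - 2 * pmf p i * ?N xs)"
    unfolding m by (intro iidE_cong) (simp add: power2_eq_square algebra_simps)
  also have "\<dots> = iidE p (m - 1) (\<lambda>xs. (?N xs - ?\<mu>)\<^sup>2) + (pmf p i)\<^sup>2"
    unfolding iidE_add iidE_diff iidE_cmult iidE_const[OF fin] iidE_count[OF fin]
    by (simp add: algebra_simps)
  also have "\<dots> \<le> ?\<mu> + pmf p i"
    using iidE_count_variance[OF fin, of "m - 1" i]
    by (intro add_mono) (simp_all add: power2_eq_square mult_left_le pmf_le_1)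
  also have "\<dots> = real m * pmf p i" unfolding m by (simp add: algebra_simps)
  finally show ?thesis .
qed

section \<open>Mean and variance of the bilinear statistic\<close>

definition clip_count :: "(nat \<Rightarrow> real) \<Rightarrow> (nat \<Rightarrow> real) \<Rightarrow> nat list \<Rightarrow> nat \<Rightarrow> real" where
  "clip_count T \<mu> xs i = clip (T i) (real (count_list xs i) - \<mu> i)"

definition bilin :: "nat set \<Rightarrow> (nat \<Rightarrow> real) \<Rightarrow> (nat \<Rightarrow> real) \<Rightarrow> (nat \<Rightarrow> real) \<Rightarrow> nat list \<Rightarrow> nat list \<Rightarrow> real" where
  "bilin I W T \<mu> xs ys = (\<Sum>i\<in>I. clip_count T \<mu> xs i * clip_count T \<mu> ys i / W i)"

text \<open>Efron-Stein factor of coordinate \<open>i\<close>: the mean squared effect of one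
  further sample on the clipped count. It is small when the count lies mostly above the threshold,
  which tames coordinates of large mass.\<close>

definition clip_slope :: "nat pmf \<Rightarrow> nat \<Rightarrow> (nat \<Rightarrow> real) \<Rightarrow> (nat \<Rightarrow> real) \<Rightarrow> nat \<Rightarrow> real" where
  "clip_slope p m T \<mu> i = iidE p (m - 1) (\<lambda>xs.
    (clip (T i) (real (count_list xs i) - \<mu> i + 1) - clip (T i) (real (count_list xs i) - \<mu> i))\<^sup>2)"

text \<open>Efron-Stein, where a sample of value \<open>x\<close> moves only the term of index
  \<open>x\<close>.\<close>

lemma variance_linear_clip_count:
  assumes I: "finite I" "set_pmf p \<subseteq> I"
  shows "iidE p m (\<lambda>xs. (\<Sum>i\<in>I. a i * clip_count T \<mu> xs i)\<^sup>2) \<le>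
    (\<Sum>i\<in>I. a i * iidE p m (\<lambda>xs. clip_count T \<mu> xs i))\<^sup>2 +
    (\<Sum>i\<in>I. real m * pmf p i * clip_slope p m T \<mu> i * (a i)\<^sup>2)"
proof -
  have fin: "finite (set_pmf p)" using I finite_subset by blast
  let ?f = "\<lambda>xs. \<Sum>i\<in>I. a i * clip_count T \<mu> xs i"
  let ?D = "\<lambda>xs i. (clip (T i) (real (count_list xs i) - \<mu> i + 1) - clip (T i) (real (count_list xs i) - \<mu> i))\<^sup>2"
  have "iidE p m (\<lambda>xs. (?f xs)\<^sup>2) - (iidE p m ?f)\<^sup>2 \<le>
    real m * iidE p (m - 1) (\<lambda>xs. \<Sum>x\<in>set_pmf p. pmf p x * (?f (x # xs) - ?f xs)\<^sup>2)"
  proof (intro iidE_Efron_Stein fin)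
    fix xs ys :: "nat list"
    assume "mset xs = mset ys"
    then have "count_list xs = count_list ys" by (metis count_mset ext)
    then show "?f xs = ?f ys" by (simp add: clip_count_def)
  qed
  also have "iidE p (m - 1) (\<lambda>xs. \<Sum>x\<in>set_pmf p. pmf p x * (?f (x # xs) - ?f xs)\<^sup>2) =
    iidE p (m - 1) (\<lambda>xs. \<Sum>x\<in>I. pmf p x * (a x)\<^sup>2 * ?D xs x)"
  proof (intro iidE_cong)
    fix xs
    have "?f (x # xs) - ?f xs = a x * (clip (T x) (real (count_list xs x) - \<mu> x + 1) - clip (T x) (real (count_list xs x) - \<mu> x))"
      if "x \<in> I" for x
    proof -
      have "?f (x # xs) - ?f xs = (\<Sum>i\<in>I. a i * (clip_count T \<mu> (x # xs) i - clip_count T \<mu> xs i))"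
        by (simp add: sum_subtractf right_diff_distrib)
      also have "\<dots> = (\<Sum>i\<in>I. if i = x then a x * (clip_count T \<mu> (x # xs) x - clip_count T \<mu> xs x) else 0)"
        by (intro sum.cong) (auto simp: clip_count_def)
      finally show ?thesis using that I(1) by (simp add: clip_count_def algebra_simps)
    qed
    then have "(\<Sum>x\<in>I. pmf p x * (a x)\<^sup>2 * ?D xs x) = (\<Sum>x\<in>I. pmf p x * (?f (x # xs) - ?f xs)\<^sup>2)"
      by (intro sum.cong) (simp_all add: power_mult_distrib)
    also have "\<dots> = (\<Sum>x\<in>set_pmf p. pmf p x * (?f (x # xs) - ?f xs)\<^sup>2)"
      using I by (intro sum.mono_neutral_right) (auto simp: set_pmf_iff)
    finally show "(\<Sum>x\<in>set_pmf p. pmf p x * (?f (x # xs) - ?f xs)\<^sup>2) = (\<Sum>x\<in>I. pmf p x * (a x)\<^sup>2 * ?D xs x)"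
      by simp
  qed
  also have "real m * \<dots> = (\<Sum>i\<in>I. real m * pmf p i * clip_slope p m T \<mu> i * (a i)\<^sup>2)"
    unfolding iidE_sum iidE_cmult sum_distrib_left clip_slope_def by (intro sum.cong) auto
  finally show ?thesis by (simp add: iidE_sum iidE_cmult)
qed

text \<open>The halves are independent with the same law, so each coordinate contributes the product
  of two equal means.\<close>

lemma mean_bilin:
  "iidE p m (\<lambda>xs. iidE p m (bilin I W T \<mu> xs)) = (\<Sum>i\<in>I. (iidE p m (\<lambda>xs. clip_count T \<mu> xs i))\<^sup>2 / W i)"
proof -
  let ?e = "\<lambda>i. iidE p m (\<lambda>xs. clip_count T \<mu> xs i)"
  have "iidE p m (bilin I W T \<mu> xs) = (\<Sum>i\<in>I. (?e i / W i) * clip_count T \<mu> xs i)" for xs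
  proof -
    have "iidE p m (bilin I W T \<mu> xs) = iidE p m (\<lambda>ys. \<Sum>i\<in>I. (clip_count T \<mu> xs i / W i) * clip_count T \<mu> ys i)"
      by (simp add: bilin_def[abs_def])
    then show ?thesis unfolding iidE_sum iidE_cmult by (simp add: mult.commute)
  qed
  then show ?thesis by (simp only: iidE_sum iidE_cmult) (simp add: power2_eq_square)
qed

text \<open>The variance splits into that of the statistic given the first half and that of its
  conditional mean; both are variances of linear forms in the clipped counts.\<close>

lemma second_moment_bilin:
  fixes p :: "nat pmf" and m :: nat and T \<mu> :: "nat \<Rightarrow> real"
  assumes I: "finite I" "set_pmf p \<subseteq> I"
  defines "e \<equiv> \<lambda>i. iidE p m (\<lambda>xs. clip_count T \<mu> xs i)"
  shows "iidE p m (\<lambda>xs. iidE p m (\<lambda>ys. (bilin I W T \<mu> xs ys)\<^sup>2)) \<le> (\<Sum>i\<in>I. (e i)\<^sup>2 / W i)\<^sup>2 +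
    (\<Sum>i\<in>I. real m * pmf p i * clip_slope p m T \<mu> i *
      (iidE p m (\<lambda>xs. (clip_count T \<mu> xs i)\<^sup>2) + (e i)\<^sup>2) / (W i)\<^sup>2)"
proof -
  let ?c = "clip_count T \<mu>"
  define v where "v i = real m * pmf p i * clip_slope p m T \<mu> i" for i
  have 1: "iidE p m (\<lambda>ys. (bilin I W T \<mu> xs ys)\<^sup>2) \<le>
    (\<Sum>i\<in>I. (e i / W i) * ?c xs i)\<^sup>2 + (\<Sum>i\<in>I. (v i / (W i)\<^sup>2) * (?c xs i)\<^sup>2)" for xs
    using variance_linear_clip_count[OF I, of m "\<lambda>i. ?c xs i / W i" T \<mu>]
    by (simp add: bilin_def e_def v_def power_divide mult.commute)
  have "iidE p m (\<lambda>xs. iidE p m (\<lambda>ys. (bilin I W T \<mu> xs ys)\<^sup>2)) \<le>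
    iidE p m (\<lambda>xs. (\<Sum>i\<in>I. (e i / W i) * ?c xs i)\<^sup>2) + (\<Sum>i\<in>I. (v i / (W i)\<^sup>2) * iidE p m (\<lambda>xs. (?c xs i)\<^sup>2))"
    unfolding iidE_cmult[symmetric] iidE_sum[symmetric] iidE_add[symmetric] by (intro iidE_mono 1)
  \<comment> \<open>The conditional mean given the first half is again a linear form, with
    coefficients \<open>e i / W i\<close>.\<close>
  also have "\<dots> \<le> (\<Sum>i\<in>I. (e i / W i) * e i)\<^sup>2 + (\<Sum>i\<in>I. v i * (e i / W i)\<^sup>2) +
    (\<Sum>i\<in>I. (v i / (W i)\<^sup>2) * iidE p m (\<lambda>xs. (?c xs i)\<^sup>2))"
    using variance_linear_clip_count[OF I, of m "\<lambda>i. e i / W i" T \<mu>]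
    by (simp add: e_def v_def)
  also have "\<dots> = (\<Sum>i\<in>I. (e i)\<^sup>2 / W i)\<^sup>2 +
    (\<Sum>i\<in>I. v i * (iidE p m (\<lambda>xs. (?c xs i)\<^sup>2) + (e i)\<^sup>2) / (W i)\<^sup>2)"
    unfolding add.assoc sum.distrib[symmetric]
    by (intro arg_cong2[where f = "(+)"] arg_cong[where f = "\<lambda>x. x\<^sup>2"] sum.cong refl)
      (auto simp: power2_eq_square add_divide_distrib algebra_simps)
  finally show ?thesis unfolding v_def .
qed

section \<open>Signal of one coordinate\<close>

lemma clip_count_mean_near:
  assumes fin: "finite (set_pmf p)" and "0 < T i" "\<bar>real m * pmf p i - \<mu> i\<bar> \<le> T i / 2"
  shows "\<bar>iidE p m (\<lambda>xs. clip_count T \<mu> xs i) - (real m * pmf p i - \<mu> i)\<bar> \<le> real m * pmf p i / (2 * T i)"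
proof -
  let ?N = "\<lambda>xs. real (count_list xs i)" and ?l = "real m * pmf p i"
  \<comment> \<open>Without clipping the mean is exactly \<open>?l - \<mu> i\<close>; only the bias
    of clipping remains.\<close>
  have "iidE p m (\<lambda>xs. clip_count T \<mu> xs i) - (?l - \<mu> i) = iidE p m (\<lambda>xs. clip_count T \<mu> xs i - (?N xs - \<mu> i))"
    by (simp add: iidE_diff iidE_count iidE_const fin)
  also have "\<bar>\<dots>\<bar> \<le> iidE p m (\<lambda>xs. 1 / (2 * T i) * (?N xs - ?l)\<^sup>2)"
  proof (intro iidE_abs_le)
    fix xs
    show "\<bar>clip_count T \<mu> xs i - (?N xs - \<mu> i)\<bar> \<le> 1 / (2 * T i) * (?N xs - ?l)\<^sup>2"
      using clip_near[OF assms(2,3), of "?N xs - \<mu> i"] by (simp add: clip_count_def)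
  qed
  also have "\<dots> \<le> 1 / (2 * T i) * ?l"
    unfolding iidE_cmult using assms(2) by (intro mult_left_mono iidE_count_variance fin) simp
  finally show ?thesis by simp
qed

text \<open>In the mean, \<open>clip_far\<close> yields half of
  \<open>min \<bar>d\<bar> (T i)\<close> minus a multiple of the relative variance; the numeric
  assumptions keep this loss below a quarter.\<close>

lemma clip_count_mean_far:
  fixes p :: "nat pmf" and m i :: nat and T \<mu> :: "nat \<Rightarrow> real"
  assumes fin: "finite (set_pmf p)"
  defines "d \<equiv> real m * pmf p i - \<mu> i"
  assumes d: "T i / 2 < \<bar>d\<bar>" and l: "real m * pmf p i \<le> W + \<bar>d\<bar>"
    and W: "0 < W" and T: "(T i)\<^sup>2 = G * W" "192 \<le> T i" and G: "384 \<le> G"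
  shows "min \<bar>d\<bar> (T i) / 4 \<le> \<bar>iidE p m (\<lambda>xs. clip_count T \<mu> xs i)\<bar>"
proof -
  let ?N = "\<lambda>xs. real (count_list xs i)" and ?l = "real m * pmf p i"
  let ?D = "min \<bar>d\<bar> (T i)" and ?e = "iidE p m (\<lambda>xs. clip_count T \<mu> xs i)"
  have T0: "0 < T i" using T by simp
  have "?D / 2 - 6 * T i / d\<^sup>2 * iidE p m (\<lambda>xs. (?N xs - ?l)\<^sup>2) =
    iidE p m (\<lambda>xs. ?D / 2 - 6 * T i / d\<^sup>2 * (?N xs - ?l)\<^sup>2)"
    by (simp only: iidE_diff iidE_cmult iidE_const[OF fin])
  also have "\<dots> \<le> iidE p m (\<lambda>xs. sgn d * clip_count T \<mu> xs i)"
  proof (intro iidE_mono)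
    fix xs
    show "?D / 2 - 6 * T i / d\<^sup>2 * (?N xs - ?l)\<^sup>2 \<le> sgn d * clip_count T \<mu> xs i"
      using clip_far[OF T0 d, of "?N xs - \<mu> i"] by (simp add: clip_count_def d_def)
  qed
  also have "\<dots> = sgn d * ?e" by (rule iidE_cmult)
  also have "\<dots> \<le> \<bar>?e\<bar>" by (auto simp: sgn_if)
  finally have 1: "?D / 2 - 6 * T i / d\<^sup>2 * iidE p m (\<lambda>xs. (?N xs - ?l)\<^sup>2) \<le> \<bar>?e\<bar>" .
  \<comment> \<open>The parts with \<open>W\<close> and \<open>\<bar>d\<bar>\<close> each cost at
    most \<open>?D / 8\<close>: \<open>384 \<le> G\<close> and
    \<open>T i \<le> 2 * \<bar>d\<bar>\<close> give \<open>96 * W \<le> d\<^sup>2\<close>, and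
    \<open>192 \<le> T i\<close> gives \<open>96 \<le> ?D\<close>.\<close>
  have "6 * T i / d\<^sup>2 * iidE p m (\<lambda>xs. (?N xs - ?l)\<^sup>2) \<le> 6 * T i / d\<^sup>2 * (W + \<bar>d\<bar>)"
    using T0 l iidE_count_variance[OF fin, of m i] by (intro mult_left_mono) auto
  also have "\<dots> \<le> ?D / 4"
  proof -
    have D: "T i \<le> 2 * ?D" "96 \<le> ?D" "T i \<le> 2 * \<bar>d\<bar>" using d T by auto
    have d0: "0 < \<bar>d\<bar>" "0 < d\<^sup>2" using d T0 by auto
    have "6 * T i * W \<le> ?D / 8 * d\<^sup>2"
    proof -
      have "384 * W \<le> G * W"
        using W G by (intro mult_right_mono) auto
      also have "\<dots> = (T i)\<^sup>2" using T by simp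
      also have "\<dots> \<le> (2 * \<bar>d\<bar>)\<^sup>2" using D T0 by (intro power_mono) auto
      finally have Wd: "96 * W \<le> d\<^sup>2" by (simp add: power_mult_distrib)
      have "96 * (6 * T i * W) = 6 * T i * (96 * W)" by simp
      also have "\<dots> \<le> 6 * T i * d\<^sup>2" using Wd T0 by (intro mult_left_mono) auto
      also have "\<dots> \<le> 12 * ?D * d\<^sup>2" using D d0 by (intro mult_right_mono) auto
      finally show ?thesis by (simp add: mult.commute)
    qed
    moreover have "6 * T i * \<bar>d\<bar> \<le> ?D / 8 * d\<^sup>2"
    proof -
      have "6 * T i * \<bar>d\<bar> \<le> 12 * \<bar>d\<bar> * \<bar>d\<bar>" using D d0 by (intro mult_right_mono) auto
      also have "\<dots> = 12 * d\<^sup>2" by (simp add: power2_eq_square)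
      also have "\<dots> \<le> ?D / 8 * d\<^sup>2" using D d0 by (intro mult_right_mono) auto
      finally show ?thesis .
    qed
    ultimately have "6 * T i * (W + \<bar>d\<bar>) \<le> ?D / 4 * d\<^sup>2" by (simp add: distrib_left)
    then have "6 * T i * (W + \<bar>d\<bar>) / d\<^sup>2 \<le> ?D / 4" by (subst pos_divide_le_eq[OF d0(2)])
    then show ?thesis by simp
  qed
  finally show ?thesis using 1 by linarith
qed

text \<open>For \<open>\<bar>d\<bar> \<le> T i / 2\<close> the mean is \<open>d\<close> up to a bias
  of at most \<open>b + \<bar>d\<bar> / 4\<close> with \<open>b = W / (2 * T i)\<close>; the term
  \<open>1 / (4 * G)\<close> is \<open>b\<^sup>2 / W\<close>. Larger \<open>\<bar>d\<bar>\<close>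
  falls under \<open>clip_count_mean_far\<close>.\<close>

lemma clip_count_signal:
  fixes p :: "nat pmf" and m i :: nat and T \<mu> :: "nat \<Rightarrow> real"
  assumes fin: "finite (set_pmf p)"
  defines "d \<equiv> real m * pmf p i - \<mu> i"
  assumes \<mu>: "0 \<le> \<mu> i" "\<mu> i \<le> W" and W: "0 < W"
    and T: "(T i)\<^sup>2 = G * W" "192 \<le> T i" and G: "384 \<le> G"
  shows "(min \<bar>d\<bar> (T i))\<^sup>2 / (16 * W) - 1 / (4 * G) \<le> (iidE p m (\<lambda>xs. clip_count T \<mu> xs i))\<^sup>2 / W"
proof -
  let ?e = "iidE p m (\<lambda>xs. clip_count T \<mu> xs i)" and ?l = "real m * pmf p i"
  have l: "?l \<le> W + \<bar>d\<bar>" using \<mu> by (auto simp: d_def)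
  have T0: "0 < T i" using T by simp
  have "(min \<bar>d\<bar> (T i))\<^sup>2 / 16 - W\<^sup>2 / (4 * (T i)\<^sup>2) \<le> ?e\<^sup>2"
  proof (cases "\<bar>d\<bar> \<le> T i / 2")
    case True
    define b where "b = W / (2 * T i)"
    have "\<bar>?e - d\<bar> \<le> ?l / (2 * T i)"
      using clip_count_mean_near[of p T i m \<mu>] fin T0 True by (simp add: d_def)
    also have "\<dots> \<le> (W + \<bar>d\<bar>) / (2 * T i)" using l T0 by (intro divide_right_mono) auto
    also have "\<dots> = b + \<bar>d\<bar> / (2 * T i)" by (simp add: b_def add_divide_distrib)
    also have "\<bar>d\<bar> / (2 * T i) \<le> \<bar>d\<bar> / 4" using T by (intro divide_left_mono) auto
    finally have "3 / 4 * \<bar>d\<bar> \<le> \<bar>?e\<bar> + b" by linarith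
    then have "(3 / 4 * \<bar>d\<bar>)\<^sup>2 \<le> (\<bar>?e\<bar> + b)\<^sup>2" by (intro power_mono) auto
    also have "\<dots> \<le> 2 * ?e\<^sup>2 + 2 * b\<^sup>2"
      using sum_squares_bound[of "\<bar>?e\<bar>" b] by (simp add: power2_sum)
    finally have "9 / 32 * d\<^sup>2 - b\<^sup>2 \<le> ?e\<^sup>2" by (simp add: power_mult_distrib power_divide)
    moreover have "(min \<bar>d\<bar> (T i))\<^sup>2 \<le> d\<^sup>2" using T0 power_mono[of "min \<bar>d\<bar> (T i)" "\<bar>d\<bar>" 2] by simp
    moreover have "b\<^sup>2 = W\<^sup>2 / (4 * (T i)\<^sup>2)" by (simp add: b_def power_divide power_mult_distrib)
    ultimately show ?thesis using zero_le_power2[of d] by linarith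
  next
    case False
    then have "min \<bar>d\<bar> (T i) / 4 \<le> \<bar>?e\<bar>"
      using clip_count_mean_far[OF fin, of T i m \<mu> W G] l T G W by (simp add: d_def)
    then have "(min \<bar>d\<bar> (T i) / 4)\<^sup>2 \<le> \<bar>?e\<bar>\<^sup>2" using T0 by (intro power_mono) auto
    then have "(min \<bar>d\<bar> (T i))\<^sup>2 / 16 \<le> ?e\<^sup>2" by (simp add: power_divide)
    moreover have "0 \<le> W\<^sup>2 / (4 * (T i)\<^sup>2)" by simp
    ultimately show ?thesis by linarith
  qed
  then have "((min \<bar>d\<bar> (T i))\<^sup>2 / 16 - W\<^sup>2 / (4 * (T i)\<^sup>2)) / W \<le> ?e\<^sup>2 / W"
    using W by (intro divide_right_mono) auto
  moreover have "W\<^sup>2 / (4 * (T i)\<^sup>2) / W = 1 / (4 * G)"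
    using W G unfolding T(1) by (simp add: power2_eq_square field_simps)
  ultimately show ?thesis by (simp add: diff_divide_distrib)
qed

section \<open>Noise of one coordinate\<close>

lemma clip_slope_bounds:
  assumes fin: "finite (set_pmf p)"
  shows "0 \<le> clip_slope p m T \<mu> i" "clip_slope p m T \<mu> i \<le> 1"
proof -
  have "iidE p (m - 1) (\<lambda>_. 0) \<le> clip_slope p m T \<mu> i"
    unfolding clip_slope_def by (intro iidE_mono) simp
  then show "0 \<le> clip_slope p m T \<mu> i" by (simp add: iidE_const fin)
  have "clip_slope p m T \<mu> i \<le> iidE p (m - 1) (\<lambda>_. 1)"
    unfolding clip_slope_def by (intro iidE_mono clip_increment_square_le)
  then show "clip_slope p m T \<mu> i \<le> 1" by (simp add: iidE_const fin)
qed

lemma clip_slope_far: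
  fixes p :: "nat pmf" and m i :: nat and T \<mu> :: "nat \<Rightarrow> real"
  assumes fin: "finite (set_pmf p)" and "1 \<le> m"
  defines "d \<equiv> real m * pmf p i - \<mu> i"
  assumes "0 < T i" "2 * T i < d"
  shows "clip_slope p m T \<mu> i \<le> 4 / d\<^sup>2 * (real m * pmf p i)"
proof -
  have "clip_slope p m T \<mu> i \<le> iidE p (m - 1) (\<lambda>xs. 4 / d\<^sup>2 * (real (count_list xs i) - real m * pmf p i)\<^sup>2)"
    unfolding clip_slope_def
  proof (intro iidE_mono)
    fix xs
    let ?x = "real (count_list xs i) - \<mu> i"
    show "(clip (T i) (?x + 1) - clip (T i) ?x)\<^sup>2 \<le> 4 / d\<^sup>2 * (real (count_list xs i) - real m * pmf p i)\<^sup>2"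
      using clip_increment_far[OF assms(4,5), of ?x] by (simp add: d_def)
  qed
  also have "\<dots> \<le> 4 / d\<^sup>2 * (real m * pmf p i)"
    unfolding iidE_cmult by (intro mult_left_mono iidE_count_deviation_pred assms) simp
  finally show ?thesis .
qed

text \<open>The second bound expands around the true mean, where the cross term vanishes; once
  \<open>\<bar>d\<bar>\<close> exceeds the threshold, the first bound takes over.\<close>

lemma clip_count_second_moment:
  fixes p :: "nat pmf" and m i :: nat and T \<mu> :: "nat \<Rightarrow> real"
  assumes fin: "finite (set_pmf p)" and T: "0 \<le> T i"
  defines "d \<equiv> real m * pmf p i - \<mu> i"
  shows "iidE p m (\<lambda>xs. (clip_count T \<mu> xs i)\<^sup>2) \<le> (T i)\<^sup>2"
    and "iidE p m (\<lambda>xs. (clip_count T \<mu> xs i)\<^sup>2) \<le> real m * pmf p i + (min \<bar>d\<bar> (T i))\<^sup>2"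
proof -
  let ?N = "\<lambda>xs. real (count_list xs i)" and ?l = "real m * pmf p i"
  have "iidE p m (\<lambda>xs. (clip_count T \<mu> xs i)\<^sup>2) \<le> iidE p m (\<lambda>_. (T i)\<^sup>2)"
    unfolding clip_count_def by (intro iidE_mono clip_square_le T)
  then show 1: "iidE p m (\<lambda>xs. (clip_count T \<mu> xs i)\<^sup>2) \<le> (T i)\<^sup>2" by (simp add: iidE_const fin)
  have "iidE p m (\<lambda>xs. (clip_count T \<mu> xs i)\<^sup>2) \<le> iidE p m (\<lambda>xs. (?N xs - ?l)\<^sup>2 + (2 * d * (?N xs - ?l) + d\<^sup>2))"
  proof (intro iidE_mono)
    fix xs
    have "(clip_count T \<mu> xs i)\<^sup>2 \<le> (?N xs - \<mu> i)\<^sup>2"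
      unfolding clip_count_def by (intro clip_square_le T)
    also have "\<dots> = (?N xs - ?l)\<^sup>2 + (2 * d * (?N xs - ?l) + d\<^sup>2)"
      by (simp add: d_def power2_eq_square algebra_simps)
    finally show "(clip_count T \<mu> xs i)\<^sup>2 \<le> \<dots>" .
  qed
  also have "\<dots> = iidE p m (\<lambda>xs. (?N xs - ?l)\<^sup>2) + d\<^sup>2"
    unfolding iidE_add iidE_cmult iidE_diff iidE_const[OF fin] iidE_count[OF fin] by simp
  also have "\<dots> \<le> ?l + d\<^sup>2" using iidE_count_variance[OF fin, of m i] by simp
  finally have 2: "iidE p m (\<lambda>xs. (clip_count T \<mu> xs i)\<^sup>2) \<le> ?l + d\<^sup>2" .
  show "iidE p m (\<lambda>xs. (clip_count T \<mu> xs i)\<^sup>2) \<le> ?l + (min \<bar>d\<bar> (T i))\<^sup>2"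
  proof (cases "\<bar>d\<bar> \<le> T i")
    case True
    then show ?thesis using 2 by simp
  next
    case False
    then have "(min \<bar>d\<bar> (T i))\<^sup>2 = (T i)\<^sup>2" by simp
    moreover have "0 \<le> ?l" by simp
    ultimately show ?thesis using 1 by linarith
  qed
qed

text \<open>Three ranges of the excess \<open>d\<close>. For \<open>d \<le> W\<close> the variance
  factor \<open>real m * pmf p i\<close> is at most \<open>2 * W\<close>. For
  \<open>W < d \<le> 2 * T i\<close> it is at most \<open>4 * D\<close>, and \<open>r\<close> pays
  for the surplus powers of \<open>D\<close>. Beyond that clipping saturates: the slope decays like
  \<open>1 / d\<close> and the second moment is capped by \<open>(T i)\<^sup>2\<close>.\<close>

lemma clip_count_noise:
  fixes p :: "nat pmf" and m i :: nat and T \<mu> :: "nat \<Rightarrow> real"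
  assumes fin: "finite (set_pmf p)" and m: "1 \<le> m"
  defines "d \<equiv> real m * pmf p i - \<mu> i"
  defines "D \<equiv> min \<bar>d\<bar> (T i)"
  assumes \<mu>: "0 \<le> \<mu> i" "\<mu> i \<le> W" and W: "0 < W" and T: "0 < T i"
    and r: "1 / W \<le> r" "T i / W \<le> r" "1 \<le> r"
  shows "real m * pmf p i * clip_slope p m T \<mu> i *
      (iidE p m (\<lambda>xs. (clip_count T \<mu> xs i)\<^sup>2) + (iidE p m (\<lambda>xs. clip_count T \<mu> xs i))\<^sup>2) / W\<^sup>2
    \<le> 8 + 40 * r * (D\<^sup>2 / W)"
proof -
  define l where "l = real m * pmf p i"
  let ?\<rho> = "clip_slope p m T \<mu> i"
  let ?s = "iidE p m (\<lambda>xs. (clip_count T \<mu> xs i)\<^sup>2)" and ?e = "iidE p m (\<lambda>xs. clip_count T \<mu> xs i)"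
  note \<rho> = clip_slope_bounds[OF fin, of m T \<mu> i]
  have l0: "0 \<le> l" by (simp add: l_def)
  have s: "?s \<le> (T i)\<^sup>2" "?s \<le> l + D\<^sup>2"
    using clip_count_second_moment[OF fin, of T i m \<mu>] T by (simp_all add: D_def d_def l_def)
  have es: "?e\<^sup>2 \<le> ?s" by (rule iidE_square_le[OF fin])
  then have s0: "0 \<le> ?s" using zero_le_power2[of ?e] by linarith
  have D0: "0 \<le> D" using T by (simp add: D_def)
  have "l * ?\<rho> * (?s + ?e\<^sup>2) / W\<^sup>2 \<le> l * ?\<rho> * (2 * ?s) / W\<^sup>2"
    using es l0 \<rho> by (intro divide_right_mono mult_left_mono) auto
  also have "\<dots> \<le> 8 + 40 * r * (D\<^sup>2 / W)"
  proof (cases "d \<le> W")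
    case True
    have ll: "l \<le> 2 * W" using True \<mu> by (simp add: d_def l_def)
    have "l * ?\<rho> * (2 * ?s) \<le> (2 * W) * 1 * (2 * (2 * W + D\<^sup>2))"
      using ll \<rho> s l0 s0 W by (intro mult_mono) auto
    then have "l * ?\<rho> * (2 * ?s) / W\<^sup>2 \<le> (2 * W) * 1 * (2 * (2 * W + D\<^sup>2)) / W\<^sup>2"
      by (intro divide_right_mono) auto
    also have "\<dots> = 8 + 4 * 1 * (D\<^sup>2 / W)" using W by (simp add: power2_eq_square field_simps)
    also have "\<dots> \<le> 8 + 40 * r * (D\<^sup>2 / W)" using r W by (intro add_left_mono mult_right_mono) auto
    finally show ?thesis .
  next
    case False
    then have d: "W < d" "0 < d" and ll: "l \<le> 2 * d" using \<mu> W by (auto simp: d_def l_def)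
    show ?thesis
    proof (cases "d \<le> 2 * T i")
      case True
      then have dD: "d \<le> 2 * D" using d T by (auto simp: D_def)
      have "l * ?\<rho> * (2 * ?s) \<le> (4 * D) * 1 * (2 * (4 * D + D\<^sup>2))"
        using ll \<rho> s l0 s0 D0 dD by (intro mult_mono) auto
      then have "l * ?\<rho> * (2 * ?s) / W\<^sup>2 \<le> (4 * D) * 1 * (2 * (4 * D + D\<^sup>2)) / W\<^sup>2"
        by (intro divide_right_mono) auto
      also have "\<dots> = (32 * (1 / W) + 8 * (D / W)) * (D\<^sup>2 / W)"
        using W by (simp add: power2_eq_square field_simps)
      also have "\<dots> \<le> (40 * r) * (D\<^sup>2 / W)"
      proof (intro mult_right_mono)
        have "D / W \<le> T i / W" using W by (intro divide_right_mono) (auto simp: D_def)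
        then show "32 * (1 / W) + 8 * (D / W) \<le> 40 * r" using r by linarith
      qed (use W in simp)
      finally show ?thesis by simp
    next
      case False
      then have DT: "D = T i" using T by (simp add: D_def)
      have "?\<rho> \<le> 4 / d\<^sup>2 * l"
        using clip_slope_far[OF fin m, of T i \<mu>] T False by (simp add: d_def l_def)
      then have "l * ?\<rho> \<le> l * (4 / d\<^sup>2 * l)" using l0 by (intro mult_left_mono)
      also have "\<dots> \<le> (2 * d) * (4 / d\<^sup>2 * (2 * d))"
        using ll l0 d by (intro mult_mono) auto
      also have "\<dots> = 16" using d by (simp add: power2_eq_square)
      finally have "l * ?\<rho> * (2 * ?s) \<le> 16 * (2 * D\<^sup>2)"
        using s(1) s0 unfolding DT by (intro mult_mono) auto
      then have "l * ?\<rho> * (2 * ?s) / W\<^sup>2 \<le> 16 * (2 * D\<^sup>2) / W\<^sup>2"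
        by (intro divide_right_mono) auto
      also have "\<dots> = 32 * (1 / W) * (D\<^sup>2 / W)" by (simp add: power2_eq_square)
      also have "\<dots> \<le> 40 * r * (D\<^sup>2 / W)"
        using r W by (intro mult_right_mono) auto
      finally show ?thesis by simp
    qed
  qed
  finally show ?thesis unfolding l_def .
qed

section \<open>The batch tester\<close>

lemma sum_abs_count_list_update:
  assumes "finite I"
  shows "(\<Sum>i\<in>I. \<bar>real (count_list (xs[j := z]) i) - real (count_list xs i)\<bar>) \<le> 2"
proof (cases "j < length xs")
  case False
  then show ?thesis by (simp add: list_update_beyond)
next
  case True
  have "count_list (xs[j := z]) i + (if xs ! j = i then 1 else 0) =
    count_list xs i + (if z = i then 1 else 0)" for i
  proof -
    have "count_list xs i = count_list (take j xs @ xs ! j # drop (Suc j) xs) i"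
      using True by (simp flip: id_take_nth_drop)
    moreover have "xs[j := z] = take j xs @ z # drop (Suc j) xs"
      using True by (simp add: upd_conv_take_nth_drop)
    ultimately show ?thesis by simp
  qed
  then have "\<bar>real (count_list (xs[j := z]) i) - real (count_list xs i)\<bar> \<le>
    (if xs ! j = i then 1 else 0) + (if z = i then 1 else 0)" for i
    by (smt (verit) of_nat_1 of_nat_add of_nat_0)
  then have "(\<Sum>i\<in>I. \<bar>real (count_list (xs[j := z]) i) - real (count_list xs i)\<bar>) \<le>
    (\<Sum>i\<in>I. (if xs ! j = i then 1 else 0) + (if z = i then 1 else 0))"
    by (intro sum_mono)
  also have "\<dots> \<le> 2" using assms by (simp add: sum.distrib)
  finally show ?thesis .
qed

lemma bilin_commute: "bilin I W T \<mu> xs ys = bilin I W T \<mu> ys xs"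
  by (simp add: bilin_def mult.commute)

text \<open>A replacement moves the counts of one half by at most 2 in total, while the other half
  enters through clipped factors of size at most \<open>T i / W i\<close>. Here clipping secures
  privacy.\<close>

lemma bilin_update:
  assumes "finite I" and r0: "0 \<le> r" and T: "\<And>i. i \<in> I \<Longrightarrow> 0 \<le> T i \<and> 0 < W i \<and> T i / W i \<le> r"
  shows "\<bar>bilin I W T \<mu> (xs[j := z]) ys - bilin I W T \<mu> xs ys\<bar> \<le> 2 * r"
proof -
  let ?c = "clip_count T \<mu>"
  have "\<bar>bilin I W T \<mu> (xs[j := z]) ys - bilin I W T \<mu> xs ys\<bar> \<le>
    (\<Sum>i\<in>I. \<bar>?c (xs[j := z]) i * ?c ys i / W i - ?c xs i * ?c ys i / W i\<bar>)"
    unfolding bilin_def sum_subtractf[symmetric] by (rule sum_abs)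
  also have "\<dots> \<le> (\<Sum>i\<in>I. \<bar>real (count_list (xs[j := z]) i) - real (count_list xs i)\<bar> * r)"
  proof (intro sum_mono)
    fix i assume i: "i \<in> I"
    have "\<bar>?c ys i / W i\<bar> \<le> T i / W i"
      using T[OF i] clip_abs_le[of "T i"] by (simp add: clip_count_def divide_right_mono)
    then have 1: "\<bar>?c ys i / W i\<bar> \<le> r" using T[OF i] by linarith
    have 2: "\<bar>?c (xs[j := z]) i - ?c xs i\<bar> \<le> \<bar>real (count_list (xs[j := z]) i) - real (count_list xs i)\<bar>"
      unfolding clip_count_def by (rule order_trans[OF clip_lipschitz]) simp
    have "\<bar>?c (xs[j := z]) i * ?c ys i / W i - ?c xs i * ?c ys i / W i\<bar> =
      \<bar>?c (xs[j := z]) i - ?c xs i\<bar> * \<bar>?c ys i / W i\<bar>"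
      unfolding abs_mult[symmetric] by (simp add: left_diff_distrib diff_divide_distrib)
    also have "\<dots> \<le> \<bar>real (count_list (xs[j := z]) i) - real (count_list xs i)\<bar> * r"
      using 1 2 by (intro mult_mono) auto
    finally show "\<bar>?c (xs[j := z]) i * ?c ys i / W i - ?c xs i * ?c ys i / W i\<bar> \<le> \<dots>" .
  qed
  also have "\<dots> \<le> 2 * r"
    unfolding sum_distrib_right[symmetric]
    using sum_abs_count_list_update[OF assms(1)] r0 by (intro mult_right_mono) auto
  finally show ?thesis .
qed

section \<open>Parameters and error of a single batch\<close>

locale batch_tester =
  fixes n m :: nat and q :: "nat pmf" and \<alpha> :: real
  assumes n: "1 \<le> n" and \<alpha>: "0 < \<alpha>" "\<alpha> \<le> 1"
    and q: "set_pmf q \<subseteq> {1..n}"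
    and m_large: "2000000 * sqrt (real n) \<le> real m * \<alpha>\<^sup>2"
begin

text \<open>The admixture of the uniform distribution keeps the weights at least
  \<open>1 / n\<close> where \<open>q\<close> is small, at the price of total weight 2.\<close>

definition w where "w i = pmf q i + 1 / real n"
definition W where "W i = real m * w i"
definition \<mu> where "\<mu> i = real m * pmf q i"
text \<open>This threshold balances two demands: \<open>(T i)\<^sup>2 / W i = G\<close>, so one
  saturated coordinate carries the required signal, and
  \<open>T i / W i \<le> \<alpha> * sqrt n\<close>, which limits the effect of one sample.\<close>

definition T where "T i = real m * \<alpha> * sqrt (w i)"
definition G where "G = real m * \<alpha>\<^sup>2"
definition B where "B = bilin {1..n} W T \<mu>"
text \<open>The factor 64 puts saturation at \<open>G / 64\<close>, half of the lower bound
  \<open>G / 32\<close> for the mean of \<open>B\<close> under the alternative.\<close>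

definition V where "V zs = max 0 (min 1 (64 / G * B (take m zs) (drop m zs)))"

lemma sqrt_n: "1 \<le> sqrt (real n)"
  using n by simp

lemma G_large: "2000000 * sqrt (real n) \<le> G" "2000000 \<le> G"
  using m_large sqrt_n unfolding G_def by linarith+

lemma m_pos: "0 < real m" "1 \<le> m"
proof -
  have "m \<noteq> 0" using m_large sqrt_n by (intro notI) simp
  then show "0 < real m" "1 \<le> m" by simp_all
qed

lemma G_le_m: "G \<le> real m" "G \<le> real m * \<alpha>"
proof -
  have 1: "\<alpha>\<^sup>2 \<le> \<alpha>" using \<alpha> by (simp add: power2_eq_square mult_left_le)
  then show "G \<le> real m * \<alpha>" unfolding G_def by (intro mult_left_mono) auto
  also have "\<dots> \<le> real m" using \<alpha> by (simp add: mult_left_le)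
  finally show "G \<le> real m" .
qed

lemma w_ge: "1 / real n \<le> w i" "0 < w i"
  using n by (simp_all add: w_def add_nonneg_pos)

lemma sqrt_w_ge: "1 / sqrt (real n) \<le> sqrt (w i)"
  using real_sqrt_le_mono[OF w_ge(1)[of i]] by (simp add: real_sqrt_divide)

lemma W_pos: "0 < W i"
  using m_pos w_ge by (simp add: W_def)

lemma \<mu>_bounds: "0 \<le> \<mu> i" "\<mu> i \<le> W i"
  using m_pos by (simp_all add: \<mu>_def W_def w_def)

lemma T_square: "(T i)\<^sup>2 = G * W i"
  using w_ge[of i] by (simp add: T_def G_def W_def power_mult_distrib power2_eq_square)

lemma T_large: "192 \<le> T i"
proof -
  have "192 * sqrt (real n) \<le> real m * \<alpha>" using G_large G_le_m sqrt_n by linarith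
  then have "192 \<le> real m * \<alpha> * (1 / sqrt (real n))" using sqrt_n by (simp add: field_simps)
  also have "\<dots> \<le> T i" unfolding T_def using sqrt_w_ge \<alpha> by (intro mult_left_mono) auto
  finally show ?thesis .
qed

lemma inverse_W_le: "1 / W i \<le> sqrt (real n)"
proof -
  have "sqrt (real n) \<le> real m" using G_large G_le_m sqrt_n by linarith
  then have "sqrt (real n) * (sqrt (real n) * (1 / real n)) \<le> sqrt (real n) * (real m * w i)"
    using w_ge[of i] by (intro mult_left_mono mult_mono) auto
  then have "1 \<le> sqrt (real n) * W i" using n by (simp add: W_def)
  then show ?thesis using W_pos by (simp add: pos_divide_le_eq)
qed

lemma T_div_W_le: "T i / W i \<le> \<alpha> * sqrt (real n)"
proof -
  have "T i / W i = \<alpha> / sqrt (w i)"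
    using m_pos w_ge[of i] by (simp add: T_def W_def field_simps)
  also have "\<dots> \<le> \<alpha> / (1 / sqrt (real n))"
    using sqrt_w_ge w_ge \<alpha> sqrt_n by (intro divide_left_mono) auto
  finally show ?thesis by simp
qed

lemma T_div_W_le_sqrt: "T i / W i \<le> sqrt (real n)"
  using T_div_W_le[of i] mult_right_mono[of \<alpha> 1 "sqrt (real n)"] \<alpha> by simp

lemma sum_W: "(\<Sum>i\<in>{1..n}. W i) = 2 * real m"
  unfolding W_def w_def sum_distrib_left[symmetric] sum.distrib
  using n sum_pmf_eq_1[of "{1..n}" q] q by simp

lemma V_bounds: "0 \<le> V zs" "V zs \<le> 1"
  by (simp_all add: V_def)

text \<open>Truncation is 1-Lipschitz, and \<open>64 / G\<close> times the sensitivity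
  \<open>2 * (\<alpha> * sqrt n)\<close> of \<open>B\<close> leaves one power of \<alpha> in the
  denominator.\<close>

lemma V_update: "\<bar>V (zs[j := z]) - V zs\<bar> \<le> 128 * sqrt (real n) / (real m * \<alpha>)"
proof -
  have upd: "\<bar>B (xs[j := z]) ys - B xs ys\<bar> \<le> 2 * (\<alpha> * sqrt (real n))" for xs ys j
    unfolding B_def
    using W_pos T_div_W_le \<alpha> by (intro bilin_update) (auto intro: order_trans[OF _ T_large])
  have upd': "\<bar>B xs (ys[j := z]) - B xs ys\<bar> \<le> 2 * (\<alpha> * sqrt (real n))" for xs ys j
    using upd[of ys j xs] unfolding B_def by (simp add: bilin_commute)
  have "\<bar>B (take m (zs[j := z])) (drop m (zs[j := z])) - B (take m zs) (drop m zs)\<bar> \<le> 2 * (\<alpha> * sqrt (real n))"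
  proof (cases "j < m")
    case True
    then show ?thesis using upd by (simp add: take_update_swap)
  next
    case False
    then show ?thesis using upd' by (simp add: drop_update_swap)
  qed
  then have "64 / G * \<bar>B (take m (zs[j := z])) (drop m (zs[j := z])) - B (take m zs) (drop m zs)\<bar> \<le>
    64 / G * (2 * (\<alpha> * sqrt (real n)))"
    using G_large by (intro mult_left_mono) auto
  also have "\<dots> = 128 * sqrt (real n) / (real m * \<alpha>)"
    using \<alpha> by (simp add: G_def power2_eq_square)
  finally have *: "\<bar>64 / G * B (take m (zs[j := z])) (drop m (zs[j := z])) - 64 / G * B (take m zs) (drop m zs)\<bar> \<le>
    128 * sqrt (real n) / (real m * \<alpha>)"
    using G_large unfolding right_diff_distrib[symmetric] abs_mult by simp
  have "\<bar>max 0 (min 1 x) - max 0 (min 1 y)\<bar> \<le> \<bar>x - y\<bar>" for x y :: real by linarith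
  then show ?thesis unfolding V_def using * by (rule order_trans)
qed

lemma iidE_V: "iidE p (m + m) (\<lambda>zs. F (V zs)) = iidE p m (\<lambda>xs. iidE p m (\<lambda>ys. F (max 0 (min 1 (64 / G * B xs ys)))))"
  unfolding iidE_append by (intro iidE_cong) (simp add: V_def)

text \<open>For \<open>p = q\<close> the clipped means are pure clipping bias, contributing at most
  \<open>n / (4 * G)\<close> to the mean of \<open>B\<close>, and the noise is at most 8 per
  coordinate. The second moment of \<open>B\<close> is thus of order \<open>n\<close>, far below
  \<open>G\<^sup>2\<close>.\<close>

lemma mean_V_null: "iidE q (m + m) V \<le> 1 / 8"
proof -
  have fin: "finite (set_pmf q)" using q finite_subset by blast
  let ?e = "\<lambda>i. iidE q m (\<lambda>xs. clip_count T \<mu> xs i)"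
  have T0: "0 < T i" for i using T_large[of i] by simp
  have G0: "0 < G" using G_large by simp
  have e: "(?e i)\<^sup>2 / W i \<le> 1 / (4 * G)" for i
  proof -
    have "\<bar>?e i\<bar> \<le> \<mu> i / (2 * T i)"
      using clip_count_mean_near[of q T i m \<mu>] fin T0[of i] by (simp add: \<mu>_def)
    also have "\<dots> \<le> W i / (2 * T i)" using \<mu>_bounds T0[of i] by (intro divide_right_mono) auto
    finally have "\<bar>?e i\<bar>\<^sup>2 \<le> (W i / (2 * T i))\<^sup>2" by (intro power_mono) auto
    then have "(?e i)\<^sup>2 / W i \<le> (W i / (2 * T i))\<^sup>2 / W i" using W_pos[of i] by (intro divide_right_mono) auto
    also have "\<dots> = 1 / (4 * G)"
      unfolding power_divide power_mult_distrib T_square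
      using W_pos[of i] G0 by (simp add: power2_eq_square)
    finally show ?thesis .
  qed
  have sum_e: "(\<Sum>i\<in>{1..n}. (?e i)\<^sup>2 / W i) \<le> real n / (4 * G)"
    using sum_mono[of "{1..n}" "\<lambda>i. (?e i)\<^sup>2 / W i" "\<lambda>_. 1 / (4 * G)"] e by simp
  have noise: "real m * pmf q i * clip_slope q m T \<mu> i *
      (iidE q m (\<lambda>xs. (clip_count T \<mu> xs i)\<^sup>2) + (?e i)\<^sup>2) / (W i)\<^sup>2 \<le> 8" for i
    using clip_count_noise[OF fin m_pos(2), of \<mu> i "W i" T "sqrt n"]
      \<mu>_bounds W_pos T0 inverse_W_le sqrt_n T_div_W_le_sqrt
    by (simp add: \<mu>_def)
  have nG: "real n \<le> G\<^sup>2 / 4000000000000"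
  proof -
    have "(2000000 * sqrt (real n))\<^sup>2 \<le> G\<^sup>2" using G_large by (intro power_mono) auto
    then show ?thesis by (simp add: power_mult_distrib)
  qed
  have "iidE q m (\<lambda>xs. iidE q m (\<lambda>ys. (B xs ys)\<^sup>2)) \<le> (real n / (4 * G))\<^sup>2 + 8 * real n"
  proof -
    have "iidE q m (\<lambda>xs. iidE q m (\<lambda>ys. (B xs ys)\<^sup>2)) \<le> (\<Sum>i\<in>{1..n}. (?e i)\<^sup>2 / W i)\<^sup>2 +
      (\<Sum>i\<in>{1..n}. real m * pmf q i * clip_slope q m T \<mu> i *
        (iidE q m (\<lambda>xs. (clip_count T \<mu> xs i)\<^sup>2) + (?e i)\<^sup>2) / (W i)\<^sup>2)"
      unfolding B_def using q by (intro second_moment_bilin) auto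
    also have "\<dots> \<le> (real n / (4 * G))\<^sup>2 + (\<Sum>i\<in>{1..n}. 8)"
      using sum_e W_pos by (intro add_mono power_mono sum_mono noise) (auto intro!: sum_nonneg simp: less_imp_le)
    finally show ?thesis by simp
  qed
  also have "\<dots> \<le> G\<^sup>2 / 1000000"
  proof -
    have "real n / (4 * G) \<le> G / 1000000"
      using nG G0 by (simp add: field_simps power2_eq_square)
    then have "(real n / (4 * G))\<^sup>2 \<le> (G / 1000000)\<^sup>2" using G0 by (intro power_mono) auto
    then show ?thesis using nG zero_le_power2[of G] by (simp add: power_divide)
  qed
  finally have B2: "iidE q m (\<lambda>xs. iidE q m (\<lambda>ys. (B xs ys)\<^sup>2)) \<le> G\<^sup>2 / 1000000" .
  \<comment> \<open>The first moment is traded for the second: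
    \<open>0 \<le> (1 / 4 - 2 * v)\<^sup>2\<close> gives
    \<open>v \<le> 1 / 16 + 4 * v\<^sup>2\<close>, and 16384 is
    \<open>4 * 64\<^sup>2\<close>.\<close>
  have V: "max 0 (min 1 (64 / G * b)) \<le> 1 / 16 + 16384 / G\<^sup>2 * b\<^sup>2" for b
  proof -
    let ?v = "64 / G * b"
    have "max 0 (min 1 ?v) \<le> \<bar>?v\<bar>" by linarith
    also have "\<dots> \<le> 1 / 16 + 4 * \<bar>?v\<bar>\<^sup>2"
      using zero_le_power2[of "1 / 4 - 2 * \<bar>?v\<bar>"] by (simp add: power2_eq_square algebra_simps)
    also have "4 * \<bar>?v\<bar>\<^sup>2 = 16384 / G\<^sup>2 * b\<^sup>2" by (simp add: power_mult_distrib power_divide)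
    finally show ?thesis .
  qed
  have "iidE q (m + m) V \<le> iidE q m (\<lambda>xs. iidE q m (\<lambda>ys. 1 / 16 + 16384 / G\<^sup>2 * (B xs ys)\<^sup>2))"
    unfolding iidE_V[where F = "\<lambda>x. x"] by (intro iidE_mono V)
  also have "\<dots> = 1 / 16 + 16384 / G\<^sup>2 * iidE q m (\<lambda>xs. iidE q m (\<lambda>ys. (B xs ys)\<^sup>2))"
    by (simp only: iidE_add iidE_cmult iidE_const[OF fin])
  also have "\<dots> \<le> 1 / 16 + 16384 / G\<^sup>2 * (G\<^sup>2 / 1000000)"
    using B2 by (intro add_left_mono mult_left_mono) auto
  also have "\<dots> \<le> 1 / 8" using G0 by simp
  finally show ?thesis .
qed

text \<open>Chebyshev around the mean \<open>E\<close> of \<open>B\<close>. Mean and variance are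
  both compared with \<open>S\<close>, the clipped weighted squared distance.\<close>

lemma mean_V_alternative:
  assumes p: "set_pmf p \<subseteq> {1..n}" and far: "\<alpha> \<le> dTV n p q"
  shows "iidE p (m + m) (\<lambda>zs. 1 - V zs) \<le> 1 / 8"
proof -
  have fin: "finite (set_pmf p)" using p finite_subset by blast
  let ?e = "\<lambda>i. iidE p m (\<lambda>xs. clip_count T \<mu> xs i)"
  have T0: "0 < T i" for i using T_large[of i] by simp
  have G0: "0 < G" using G_large by simp
  define d where "d i = real m * pmf p i - \<mu> i" for i
  define D where "D i = min \<bar>d i\<bar> (T i)" for i
  define S where "S = (\<Sum>i\<in>{1..n}. (D i)\<^sup>2 / W i)"
  define E where "E = (\<Sum>i\<in>{1..n}. (?e i)\<^sup>2 / W i)"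
  \<comment> \<open>A coordinate past its threshold alone contributes
    \<open>(T i)\<^sup>2 / W i = G\<close>. Otherwise \<open>D i = \<bar>d i\<bar>\<close>
    throughout, and Cauchy-Schwarz with total weight \<open>2 * real m\<close> yields even
    \<open>2 * G\<close>.\<close>
  have S: "G \<le> S"
  proof (cases "\<exists>i\<in>{1..n}. T i < \<bar>d i\<bar>")
    case True
    then obtain i where i: "i \<in> {1..n}" "T i < \<bar>d i\<bar>" by blast
    then have "G = (D i)\<^sup>2 / W i" using W_pos[of i] by (simp add: D_def T_square)
    also have "\<dots> \<le> S"
      unfolding S_def using i W_pos by (intro member_le_sum) (auto simp: less_imp_le)
    finally show ?thesis .
  next
    case False
    then have D: "D i = \<bar>d i\<bar>" if "i \<in> {1..n}" for i using that by (force simp: D_def)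
    have sqrt: "\<bar>d i\<bar> = (\<bar>d i\<bar> / sqrt (W i)) * sqrt (W i)" for i using W_pos[of i] by simp
    have "2 * real m * \<alpha> \<le> 2 * real m * dTV n p q" using far by (intro mult_left_mono) auto
    also have "\<dots> = (\<Sum>i\<in>{1..n}. \<bar>d i\<bar>)"
      by (simp add: dTV_def d_def \<mu>_def sum_distrib_left abs_mult flip: right_diff_distrib)
    finally have "(2 * real m * \<alpha>)\<^sup>2 \<le> (\<Sum>i\<in>{1..n}. (\<bar>d i\<bar> / sqrt (W i)) * sqrt (W i))\<^sup>2"
      using \<alpha> sqrt by (intro power_mono) auto
    also have "\<dots> \<le> (\<Sum>i\<in>{1..n}. (\<bar>d i\<bar> / sqrt (W i))\<^sup>2) * (\<Sum>i\<in>{1..n}. (sqrt (W i))\<^sup>2)"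
      by (rule Cauchy_Schwarz_ineq_sum)
    also have "\<dots> = S * (2 * real m)"
      unfolding S_def sum_W[symmetric] using W_pos D
      by (intro arg_cong2[where f = "(*)"] sum.cong) (auto simp: power_divide less_imp_le)
    finally have "2 * real m * (2 * G) \<le> 2 * real m * S"
      by (simp add: G_def power2_eq_square algebra_simps)
    then have "2 * G \<le> S" using m_pos by simp
    then show ?thesis using G0 by simp
  qed
  have nG: "real n \<le> sqrt n * S / 2000000" "sqrt n * S \<le> S\<^sup>2 / 2000000"
  proof -
    have 1: "2000000 * sqrt n \<le> S" using S G_large by linarith
    have "sqrt n * sqrt n * 2000000 \<le> sqrt n * S"
      unfolding mult.assoc using 1 by (intro mult_left_mono) auto
    then show "real n \<le> sqrt n * S / 2000000" by simp
    have "2000000 * sqrt n * S \<le> S * S" using 1 S G0 by (intro mult_right_mono) auto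
    then show "sqrt n * S \<le> S\<^sup>2 / 2000000" by (simp add: power2_eq_square)
  qed
  have E: "S / 32 \<le> E"
  proof -
    have "S / 16 - real n / (4 * G) = (\<Sum>i\<in>{1..n}. (D i)\<^sup>2 / (16 * W i) - 1 / (4 * G))"
      by (simp add: S_def sum_subtractf sum_divide_distrib mult.commute)
    also have "\<dots> \<le> E"
      unfolding E_def
    proof (intro sum_mono)
      fix i
      show "(D i)\<^sup>2 / (16 * W i) - 1 / (4 * G) \<le> (?e i)\<^sup>2 / W i"
        unfolding D_def d_def
        by (intro clip_count_signal fin \<mu>_bounds W_pos T_square T_large) (use G_large in simp)
    qed
    finally have 1: "S / 16 - real n / (4 * G) \<le> E" .
    have "real n / (4 * G) \<le> S / 32"
    proof -
      have "8 * real n = (8 * sqrt n) * sqrt n" by simp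
      also have "\<dots> \<le> G * S"
      proof (intro mult_mono)
        show "8 * sqrt n \<le> G" "sqrt n \<le> S" using G_large S sqrt_n by linarith+
      qed (use G0 in auto)
      finally show ?thesis using G0 by (simp add: field_simps)
    qed
    then show ?thesis using 1 by linarith
  qed
  \<comment> \<open>\<open>S\<close> may be far larger than \<open>G\<close>, and the noise grows
    with it; hence the comparison with \<open>S\<^sup>2\<close>, for which \<open>nG\<close>
    expresses every term through \<open>S\<close>.\<close>
  have var: "iidE p m (\<lambda>xs. iidE p m (\<lambda>ys. (B xs ys)\<^sup>2)) - E\<^sup>2 \<le> S\<^sup>2 / 40000"
  proof -
    have "iidE p m (\<lambda>xs. iidE p m (\<lambda>ys. (B xs ys)\<^sup>2)) - E\<^sup>2 \<le>
      (\<Sum>i\<in>{1..n}. real m * pmf p i * clip_slope p m T \<mu> i *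
        (iidE p m (\<lambda>xs. (clip_count T \<mu> xs i)\<^sup>2) + (?e i)\<^sup>2) / (W i)\<^sup>2)"
      using second_moment_bilin[of "{1..n}" p m W T \<mu>] p by (simp add: B_def E_def)
    also have "\<dots> \<le> (\<Sum>i\<in>{1..n}. 8 + 40 * sqrt n * ((D i)\<^sup>2 / W i))"
    proof (intro sum_mono)
      fix i
      show "real m * pmf p i * clip_slope p m T \<mu> i *
        (iidE p m (\<lambda>xs. (clip_count T \<mu> xs i)\<^sup>2) + (?e i)\<^sup>2) / (W i)\<^sup>2 \<le> 8 + 40 * sqrt n * ((D i)\<^sup>2 / W i)"
        unfolding D_def d_def
        by (intro clip_count_noise fin m_pos \<mu>_bounds W_pos T0 inverse_W_le T_div_W_le_sqrt sqrt_n)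
    qed
    also have "\<dots> = 8 * real n + 40 * (sqrt n * S)"
      by (simp add: sum.distrib S_def sum_distrib_left mult.assoc)
    also have "\<dots> \<le> S\<^sup>2 / 40000" using nG zero_le_power2[of S] by linarith
    finally show ?thesis .
  qed
  have E0: "0 < E" "G / 32 \<le> E" using E S G0 by linarith+
  \<comment> \<open>\<open>V\<close> falls short of 1 only below \<open>G / 64\<close>, which is at
    most \<open>E / 2\<close>, so a shortfall forces a deviation of at least
    \<open>E / 2\<close>.\<close>
  have V: "1 - max 0 (min 1 (64 / G * b)) \<le> 4 / E\<^sup>2 * (b - E)\<^sup>2" for b
  proof (cases "G / 64 \<le> b")
    case True
    then have "1 \<le> 64 / G * b" using G0 by (simp add: field_simps)
    then show ?thesis by simp
  next
    case False
    then have "E / 2 \<le> \<bar>b - E\<bar>" using E0 by linarith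
    then have "(E / 2)\<^sup>2 \<le> \<bar>b - E\<bar>\<^sup>2" using E0 by (intro power_mono) auto
    then have "1 \<le> 4 / E\<^sup>2 * (b - E)\<^sup>2" using E0 by (simp add: field_simps)
    then show ?thesis by linarith
  qed
  have "iidE p (m + m) (\<lambda>zs. 1 - V zs) \<le> iidE p m (\<lambda>xs. iidE p m (\<lambda>ys. 4 / E\<^sup>2 * (B xs ys - E)\<^sup>2))"
    unfolding iidE_V by (intro iidE_mono V)
  also have "\<dots> = 4 / E\<^sup>2 * iidE p m (\<lambda>xs. iidE p m (\<lambda>ys. (B xs ys)\<^sup>2 - 2 * E * B xs ys + E\<^sup>2))"
    unfolding iidE_cmult
    by (intro arg_cong2[where f = "(*)"] refl iidE_cong) (simp add: power2_diff algebra_simps)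
  also have "\<dots> = 4 / E\<^sup>2 * (iidE p m (\<lambda>xs. iidE p m (\<lambda>ys. (B xs ys)\<^sup>2)) - E\<^sup>2)"
  proof -
    have "iidE p m (\<lambda>xs. iidE p m (\<lambda>ys. B xs ys)) = E"
      using mean_bilin[of p m "{1..n}" W T \<mu>] by (simp add: B_def E_def)
    then show ?thesis
      by (simp only: iidE_add iidE_diff iidE_cmult iidE_const[OF fin]) (simp add: power2_eq_square)
  qed
  also have "\<dots> \<le> 4 / E\<^sup>2 * (S\<^sup>2 / 40000)" using var by (intro mult_left_mono) auto
  also have "\<dots> \<le> 4 / E\<^sup>2 * ((32 * E)\<^sup>2 / 40000)"
    using E S G0 by (intro mult_left_mono divide_right_mono power_mono) auto
  also have "\<dots> \<le> 1 / 8" using E0 by (simp add: power_mult_distrib)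
  finally show ?thesis .
qed

end

section \<open>Choice of sizes and final assembly\<close>

lemma identity_tester_of_large_error:
  assumes "1 / 2 \<le> \<beta>I" "1 / 2 \<le> \<beta>II" "0 < \<epsilon>"
  shows "diff_private n \<epsilon> 0 (\<lambda>_. bernoulli_pmf (1 / 2))"
    and "identity_tester n q \<alpha> \<beta>I \<beta>II 0 (\<lambda>_. bernoulli_pmf (1 / 2))"
proof -
  have "x \<le> exp \<epsilon> * x" if "0 \<le> x" for x :: real
    using assms(3) that mult_right_mono[of 1 "exp \<epsilon>" x] by simp
  then show "diff_private n \<epsilon> 0 (\<lambda>_. bernoulli_pmf (1 / 2))"
    by (simp add: diff_private_def)
  \<comment> \<open>A fair coin without samples: as the error approaches 1,
    \<open>ln (1 / \<beta>)\<close> tends to zero and the sample bound eventually allows no sample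
    at all.\<close>
  show "identity_tester n q \<alpha> \<beta>I \<beta>II 0 (\<lambda>_. bernoulli_pmf (1 / 2))"
    using assms by (simp add: identity_tester_def bind_return_pmf measure_pmf_single)
qed

lemma private_identity_tester:
  fixes \<epsilon> \<alpha> \<beta> :: real
  assumes "1 \<le> n" "0 < \<epsilon>" "0 < \<alpha>" "\<alpha> \<le> 1" "0 < \<beta>" "\<beta> < 1 / 2" "is_dist_on n q"
  shows "\<exists>m M. diff_private n \<epsilon> 0 M \<and> identity_tester n q \<alpha> \<beta> \<beta> m M \<and>
    real m \<le> 30000000 * max (sqrt (real n) / \<alpha>\<^sup>2) (sqrt (real n) / (\<alpha> * \<epsilon>)) * ln (1 / \<beta>)"
proof -
  define X where "X = max (sqrt (real n) / \<alpha>\<^sup>2) (sqrt (real n) / (\<alpha> * \<epsilon>))"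
  define L where "L = ln (1 / \<beta>)"
  \<comment> \<open>\<open>m\<close> is the size of half a batch, large enough for both accuracy and
    sensitivity; \<open>k\<close> batches bring the error \<open>exp (- real k / 4)\<close> down to
    \<beta>.\<close>
  define m where "m = nat \<lceil>2000000 * X\<rceil>"
  define k where "k = nat \<lceil>4 * L\<rceil>"
  have X1: "1 \<le> X"
  proof -
    have "\<alpha>\<^sup>2 \<le> 1" using assms by (simp add: power_le_one)
    also have "1 \<le> sqrt (real n)" using assms(1) by simp
    finally have "1 \<le> sqrt (real n) / \<alpha>\<^sup>2" using assms by (simp add: le_divide_eq)
    then show ?thesis by (simp add: X_def)
  qed
  \<comment> \<open>Keeping \<open>L\<close> away from zero, like \<open>X1\<close> for
    \<open>X\<close>, makes rounding up cost only a constant factor.\<close>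
  have L: "1 / 2 \<le> L"
  proof -
    have "ln 2 \<le> L" unfolding L_def using assms by (subst ln_le_cancel_iff) (auto simp: field_simps)
    then show ?thesis using ln2_ge_two_thirds by linarith
  qed
  have m: "2000000 * X \<le> real m" "real m \<le> 2000001 * X" and k: "4 * L \<le> real k" "real k \<le> 6 * L"
    using X1 L unfolding m_def k_def by linarith+
  interpret batch_tester n m q \<alpha>
  proof
    have "2000000 * (sqrt (real n) / \<alpha>\<^sup>2) \<le> 2000000 * X" by (simp add: X_def)
    also have "\<dots> \<le> real m" by (rule m)
    finally show "2000000 * sqrt (real n) \<le> real m * \<alpha>\<^sup>2" using assms by (simp add: field_simps)
  qed (use assms in \<open>auto simp: is_dist_on_def\<close>)
  have sens: "128 * sqrt (real n) / (real m * \<alpha>) \<le> \<epsilon>"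
  proof -
    have "128 * (sqrt (real n) / (\<alpha> * \<epsilon>)) \<le> 128 * X" by (simp add: X_def)
    also have "\<dots> \<le> real m" using m X1 by linarith
    finally show ?thesis using assms m_pos by (simp add: field_simps)
  qed
  obtain M where M: "diff_private n \<epsilon> 0 M"
    "\<And>p. is_dist_on n p \<Longrightarrow> iidE p (m + m) V \<le> 1 / 8 \<Longrightarrow>
      1 - exp (- real k / 4) \<le> measure_pmf.prob (bind_pmf (sample_counts p (k * (m + m))) M) {True}"
    "\<And>p. is_dist_on n p \<Longrightarrow> iidE p (m + m) (\<lambda>xs. 1 - V xs) \<le> 1 / 8 \<Longrightarrow>
      1 - exp (- real k / 4) \<le> measure_pmf.prob (bind_pmf (sample_counts p (k * (m + m))) M) {False}"
    using diff_private_amplification[of V \<epsilon> "m + m" n k] V_bounds assms(2) order_trans[OF V_update sens]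
    by auto
  have "exp (- real k / 4) \<le> exp (- L)" using k by simp
  also have "\<dots> = \<beta>" using assms by (simp add: L_def ln_div)
  finally have \<beta>: "1 - \<beta> \<le> 1 - exp (- real k / 4)" by simp
  have "identity_tester n q \<alpha> \<beta> \<beta> (k * (m + m)) M"
    unfolding identity_tester_def
  proof (intro allI impI conjI)
    fix p assume p: "is_dist_on n p"
    show "1 - \<beta> \<le> measure_pmf.prob (bind_pmf (sample_counts p (k * (m + m))) M) {True}" if "p = q"
      using order_trans[OF \<beta> M(2)[OF p]] mean_V_null that by simp
    show "1 - \<beta> \<le> measure_pmf.prob (bind_pmf (sample_counts p (k * (m + m))) M) {False}"
      if "\<alpha> \<le> dTV n p q"
      using order_trans[OF \<beta> M(3)[OF p]] mean_V_alternative[of p] that p by (simp add: is_dist_on_def)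
  qed
  moreover have "real (k * (m + m)) \<le> 30000000 * X * L"
  proof -
    have "real (k * (m + m)) = 2 * (real k * real m)" by simp
    also have "\<dots> \<le> 2 * ((6 * L) * (2000001 * X))"
      using m k L by (intro mult_left_mono mult_mono) auto
    also have "\<dots> = 24000012 * (X * L)" by simp
    also have "\<dots> \<le> 30000000 * (X * L)" using X1 L by (intro mult_right_mono) auto
    finally show ?thesis by simp
  qed
  ultimately show ?thesis using M(1) unfolding X_def L_def by blast
qed

lemma identity_tester_mono:
  assumes "identity_tester n q \<alpha> \<beta> \<beta> m M" "\<beta> \<le> \<beta>I" "\<beta> \<le> \<beta>II"
  shows "identity_tester n q \<alpha> \<beta>I \<beta>II m M"
  using assms unfolding identity_tester_def by fastforce

theorem theorem3:
  "\<exists>C k::nat. C > 0 \<and>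
    (\<forall>(n::nat) (\<epsilon>::real) (\<alpha>::real) (\<beta>I::real) (\<beta>II::real) (q::nat pmf).
       n \<ge> 1 \<longrightarrow> \<epsilon> > 0 \<longrightarrow> 0 < \<alpha> \<longrightarrow> \<alpha> \<le> 1 \<longrightarrow>
       0 < \<beta>I \<longrightarrow> \<beta>I < 1 \<longrightarrow> 0 < \<beta>II \<longrightarrow> \<beta>II < 1 \<longrightarrow> is_dist_on n q \<longrightarrow>
       (\<exists>(m::nat) (M::(nat \<Rightarrow> nat) \<Rightarrow> bool pmf).
          diff_private n \<epsilon> 0 M \<and>
          identity_tester n q \<alpha> \<beta>I \<beta>II m M \<and>
          real m \<le> C * (1 + ln (real n)) ^ k *
            max (sqrt (real n) / \<alpha>\<^sup>2)
              (max (sqrt (real n) / (\<alpha> powr (3/2) * \<epsilon>))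
                   (real n powr (1/3) / (\<alpha> powr (5/3) * \<epsilon> powr (2/3))))
            * ln (1 / min \<beta>I \<beta>II)))"
proof (rule exI[of _ "30000000 :: real"], rule exI[of _ "0 :: nat"], intro conjI allI impI)
  fix n :: nat and \<epsilon> \<alpha> \<beta>I \<beta>II :: real and q :: "nat pmf"
  assume *: "n \<ge> 1" "\<epsilon> > 0" "0 < \<alpha>" "\<alpha> \<le> 1" "0 < \<beta>I" "\<beta>I < 1" "0 < \<beta>II" "\<beta>II < 1" "is_dist_on n q"
  let ?X = "max (sqrt (real n) / \<alpha>\<^sup>2) (max (sqrt (real n) / (\<alpha> powr (3/2) * \<epsilon>))
    (real n powr (1/3) / (\<alpha> powr (5/3) * \<epsilon> powr (2/3))))"
  define \<beta> where "\<beta> = min \<beta>I \<beta>II"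
  have \<beta>: "0 < \<beta>" "\<beta> < 1" "\<beta> \<le> \<beta>I" "\<beta> \<le> \<beta>II" using * by (auto simp: \<beta>_def)
  have ln0: "0 \<le> ln (1 / \<beta>)" using \<beta> by simp
  have X0: "0 \<le> ?X" by (simp add: le_max_iff_disj)
  have "\<exists>m M. diff_private n \<epsilon> 0 M \<and> identity_tester n q \<alpha> \<beta>I \<beta>II m M \<and>
    real m \<le> 30000000 * ?X * ln (1 / \<beta>)"
  proof (cases "\<beta> < 1 / 2")
    case False
    then have "1 / 2 \<le> \<beta>I" "1 / 2 \<le> \<beta>II" using \<beta> by linarith+
    from identity_tester_of_large_error[OF this \<open>\<epsilon> > 0\<close>] show ?thesis
      using X0 ln0 by (intro exI[of _ 0] exI[of _ "\<lambda>_. bernoulli_pmf (1 / 2)"]) simp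
  next
    case True
    obtain m M where M: "diff_private n \<epsilon> 0 M" "identity_tester n q \<alpha> \<beta> \<beta> m M"
      "real m \<le> 30000000 * max (sqrt (real n) / \<alpha>\<^sup>2) (sqrt (real n) / (\<alpha> * \<epsilon>)) * ln (1 / \<beta>)"
      using private_identity_tester[of n \<epsilon> \<alpha> \<beta> q] * \<beta> True by blast
    \<comment> \<open>As \<alpha> is at most 1, the achieved term
      \<open>sqrt (real n) / (\<alpha> * \<epsilon>)\<close> lies below the one with
      \<open>\<alpha> powr (3/2)\<close>. No logarithm of \<open>n\<close> arises, hence the
      exponent 0 chosen for the polylogarithmic factor.\<close>
    have "\<alpha> powr (3/2) \<le> \<alpha> powr 1" using * by (intro powr_mono') auto
    then have "sqrt (real n) / (\<alpha> * \<epsilon>) \<le> sqrt (real n) / (\<alpha> powr (3/2) * \<epsilon>)"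
      using * by (intro divide_left_mono mult_right_mono) auto
    then have "max (sqrt (real n) / \<alpha>\<^sup>2) (sqrt (real n) / (\<alpha> * \<epsilon>)) \<le> ?X"
      by (auto simp: le_max_iff_disj)
    then have "30000000 * max (sqrt (real n) / \<alpha>\<^sup>2) (sqrt (real n) / (\<alpha> * \<epsilon>)) * ln (1 / \<beta>) \<le>
      30000000 * ?X * ln (1 / \<beta>)"
      using ln0 by (intro mult_right_mono mult_left_mono) auto
    then have "real m \<le> 30000000 * ?X * ln (1 / \<beta>)" using M(3) by linarith
    then show ?thesis using M(1) identity_tester_mono[OF M(2) \<beta>(3,4)] by blast
  qed
  then show "\<exists>m M. diff_private n \<epsilon> 0 M \<and> identity_tester n q \<alpha> \<beta>I \<beta>II m M \<and>
    real m \<le> 30000000 * (1 + ln (real n)) ^ 0 * ?X * ln (1 / min \<beta>I \<beta>II)"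
    by (simp add: \<beta>_def)
qed simp

end
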